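(* Let $k$ be an algebraically closed field with $\operatorname{char}k=0$ or $\operatorname{char}k\ge14$, let $W$ be the Albert algebra over $k$, and let $G$ be the simply connected group of type $E_6$ stabilising its determinant. Let $\mathrm{id}_W=\sum_m x_{m,1}x_{m,2}x_{m,3}\in\operatorname{End}(W)$ (with $x_{m,i}\in W$), and define, for operators $a_1a_2a_3,b_1b_2b_3\in\operatorname{End}(W)$ (with $a_i,b_i\in W$), $$\begin{aligned}a_1a_2a_3\odot_2b_1b_2b_3:={}&\sum_{m}\sum_{\sigma\in\mathcal S_3}\sum_{\tau_a,\tau_b\in\mathcal S_3}\big((a_{\tau_a(1)}\times b_{\tau_b(1)})\times x_{m,\sigma(1)}\big)\big((a_{\tau_a(2)}\times a_{\tau_a(3)})\times(b_{\tau_b(2)}\times b_{\tau_b(3)})\big)\big(x_{m,\sigma(2)}\times x_{m,\sigma(3)}\big)\\&-\tfrac54f'(a_1a_2a_3,b_1b_2b_3)\,\mathrm{id}_W .\end{aligned}$$ Then $\odot_2$ (extended bilinearly) is a well-defined commutative $G$-equivariant product when restricted to $\sigma(V)$.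
   Context: **Albert algebra.** $\mathbb O$ is the split octonion algebra over $k$: an $8$-dimensional unital algebra with unit $e$ and nondegenerate isotropic multiplicative quadratic form $N$; $\langle x,y\rangle=N(x+y)-N(x)-N(y)$, $\overline x=\langle x,e\rangle e-x$. $W=\mathcal H_3(\mathbb O)$ is the $27$-dimensional space of hermitian matrices $x=\begin{pmatrix}\alpha_1&c&\bar b\\ \bar c&\alpha_2&a\\ b&\bar a&\alpha_3\end{pmatrix}$ with Jordan product $x\cdot y=\tfrac12(xy+yx)$, trace form $\langle x,y\rangle=\operatorname{Tr}(x\cdot y)$, determinant $\det(x)=\alpha_1\alpha_2\alpha_3-\alpha_1N(a)-\alpha_2N(b)-\alpha_3N(c)+\langle(ab)c,e\rangle$, and symmetric trilinear form $\langle x,y,z\rangle$ with $\langle x,x,x\rangle=\det(x)$. The cross product is defined by $3\langle x,y,z\rangle=\langle x\times y,z\rangle$ for all $z\in W$. $G\subset\mathrm{GL}(W)$ is the stabiliser of $\det$; it acts on $\operatorname{End}(W)$ by conjugation. **Operators.** For $x,y,z\in W$, $xyz\in\operatorname{End}(W)$ denotes $w\mapsto\langle w,x,y\rangle z+\langle w,y,z\rangle x+\langle w,z,x\rangle y$; the summands in the definition of $\odot_2$ are operators of this form. $\sigma(A(G))=\operatorname{span}_k\{a_1a_2a_3\mid a_i\in W\}$ (it contains $\mathrm{id}_W$), and $\sigma(V)$ is its subspace of trace-zero elements, i.e. $\{\sum_i a_ib_ic_i\mid\sum_i\langle a_i,b_i,c_i\rangle=0\}$ (irreducible of highest weight $\omega_1+\omega_6$).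 The form $f'$ is the bilinear form given by $f'(a_1a_2a_3,b_1b_2b_3)=\sum_{\tau_a,\tau_b\in\mathcal S_3}\langle a_{\tau_a(1)},b_{\tau_b(2)},b_{\tau_b(3)}\rangle\langle b_{\tau_b(1)},a_{\tau_a(2)},a_{\tau_a(3)}\rangle$, which is well defined on $\sigma(A(G))$. *)

theory Defs
  imports
    "HOL-Analysis.Analysis"
    "HOL-Computational_Algebra.Computational_Algebra"
    "HOL-Combinatorics.Permutations"
    "HOL-Library.Function_Algebras"
begin

section \<open>Split octonions\<close>

text \<open>The carrier is the whole type \<open>'o\<close>; its additive structure comes from the type class, the
  remaining data from the record.\<close>

record ('k, 'o) octonion_data =
  oscale :: "'k \<Rightarrow> 'o \<Rightarrow> 'o"
  omult :: "'o \<Rightarrow> 'o \<Rightarrow> 'o"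
  oone :: 'o
  onorm :: "'o \<Rightarrow> 'k"

definition opolar :: "('k::field, 'o::ab_group_add, 'm) octonion_data_scheme \<Rightarrow> 'o \<Rightarrow> 'o \<Rightarrow> 'k"
  where "opolar \<O> x y = onorm \<O> (x + y) - onorm \<O> x - onorm \<O> y"

definition oconj :: "('k::field, 'o::ab_group_add, 'm) octonion_data_scheme \<Rightarrow> 'o \<Rightarrow> 'o"
  where "oconj \<O> x = oscale \<O> (opolar \<O> x (oone \<O>)) (oone \<O>) - x"

definition split_octonion_algebra ::
    "('k::field, 'o::ab_group_add, 'm) octonion_data_scheme \<Rightarrow> bool"
  where "split_octonion_algebra \<O> \<longleftrightarrow>
    vector_space (oscale \<O>) \<and>
    vector_space.dim (oscale \<O>) (UNIV :: 'o set) = 8 \<and>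
    \<comment> \<open>unital, not necessarily associative algebra\<close>
    (\<forall>x. Vector_Spaces.linear (oscale \<O>) (oscale \<O>) (\<lambda>y. omult \<O> x y)) \<and>
    (\<forall>y. Vector_Spaces.linear (oscale \<O>) (oscale \<O>) (\<lambda>x. omult \<O> x y)) \<and>
    (\<forall>x. omult \<O> (oone \<O>) x = x \<and> omult \<O> x (oone \<O>) = x) \<and>
    \<comment> \<open>\<open>onorm \<O>\<close> is a quadratic form\<close>
    (\<forall>r x. onorm \<O> (oscale \<O> r x) = r ^ 2 * onorm \<O> x) \<and>
    (\<forall>y. Vector_Spaces.linear (oscale \<O>) (*) (\<lambda>x. opolar \<O> x y)) \<and>
    \<comment> \<open>nondegenerate, isotropic, multiplicative\<close>
    (\<forall>x. (\<forall>y. opolar \<O> x y = 0) \<longrightarrow> x = 0) \<and>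
    (\<exists>x. x \<noteq> 0 \<and> onorm \<O> x = 0) \<and>
    (\<forall>x y. onorm \<O> (omult \<O> x y) = onorm \<O> x * onorm \<O> y)"


section \<open>The Albert algebra\<close>

text \<open>\<open>Herm3 \<alpha>1 \<alpha>2 \<alpha>3 a b c\<close> stands for the hermitian matrix \<open>hmat\<close> below. Every hermitian
  \<open>3 \<times> 3\<close> matrix over the octonions has this shape for unique entries (in characteristic
  other than 2), so this type is the whole space \<open>W\<close>.\<close>

datatype ('k, 'o) herm3 = Herm3 (diag1: 'k) (diag2: 'k) (diag3: 'k) (off_a: 'o) (off_b: 'o) (off_c: 'o)

instantiation herm3 :: (ab_group_add, ab_group_add) ab_group_add
begin

definition "0 = Herm3 0 0 0 0 0 0"
definition "x + y = Herm3 (diag1 x + diag1 y) (diag2 x + diag2 y) (diag3 x + diag3 y)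
                          (off_a x + off_a y) (off_b x + off_b y) (off_c x + off_c y)"
definition "- x = Herm3 (- diag1 x) (- diag2 x) (- diag3 x) (- off_a x) (- off_b x) (- off_c x)"
definition "x - y = Herm3 (diag1 x - diag1 y) (diag2 x - diag2 y) (diag3 x - diag3 y)
                          (off_a x - off_a y) (off_b x - off_b y) (off_c x - off_c y)"

instance
  by standard
    (simp_all add: zero_herm3_def plus_herm3_def uminus_herm3_def minus_herm3_def algebra_simps)

end

definition hscale ::
    "('k::field, 'o::ab_group_add, 'm) octonion_data_scheme \<Rightarrow> 'k \<Rightarrow> ('k, 'o) herm3 \<Rightarrow> ('k, 'o) herm3"
  where "hscale \<O> r x =
    Herm3 (r * diag1 x) (r * diag2 x) (r * diag3 x)
          (oscale \<O> r (off_a x)) (oscale \<O> r (off_b x)) (oscale \<O> r (off_c x))"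

definition hmat ::
    "('k::field, 'o::ab_group_add, 'm) octonion_data_scheme \<Rightarrow> ('k, 'o) herm3 \<Rightarrow> 'o ^ 3 ^ 3"
  where "hmat \<O> x = vector
    [vector [oscale \<O> (diag1 x) (oone \<O>), off_c x, oconj \<O> (off_b x)],
     vector [oconj \<O> (off_c x), oscale \<O> (diag2 x) (oone \<O>), off_a x],
     vector [off_b x, oconj \<O> (off_a x), oscale \<O> (diag3 x) (oone \<O>)]]"

definition omat_mult ::
    "('k::field, 'o::ab_group_add, 'm) octonion_data_scheme \<Rightarrow> 'o ^ 3 ^ 3 \<Rightarrow> 'o ^ 3 ^ 3 \<Rightarrow> 'o ^ 3 ^ 3"
  where "omat_mult \<O> X Y = (\<chi> i j. \<Sum>l\<in>UNIV. omult \<O> (X $ i $ l) (Y $ l $ j))"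

definition jordan ::
    "('k::field, 'o::ab_group_add, 'm) octonion_data_scheme \<Rightarrow>
      ('k, 'o) herm3 \<Rightarrow> ('k, 'o) herm3 \<Rightarrow> ('k, 'o) herm3"
  where "jordan \<O> x y =
    (THE z. hmat \<O> z =
      (\<chi> i j. oscale \<O> (1 / 2)
        ((omat_mult \<O> (hmat \<O> x) (hmat \<O> y) + omat_mult \<O> (hmat \<O> y) (hmat \<O> x)) $ i $ j)))"

definition htrace :: "('k::field, 'o::ab_group_add) herm3 \<Rightarrow> 'k"
  where "htrace x = diag1 x + diag2 x + diag3 x"

definition trace_form ::
    "('k::field, 'o::ab_group_add, 'm) octonion_data_scheme \<Rightarrow> ('k, 'o) herm3 \<Rightarrow> ('k, 'o) herm3 \<Rightarrow> 'k"
  where "trace_form \<O> x y = htrace (jordan \<O> x y)"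

definition hdet ::
    "('k::field, 'o::ab_group_add, 'm) octonion_data_scheme \<Rightarrow> ('k, 'o) herm3 \<Rightarrow> 'k"
  where "hdet \<O> x =
    diag1 x * diag2 x * diag3 x
    - diag1 x * onorm \<O> (off_a x) - diag2 x * onorm \<O> (off_b x) - diag3 x * onorm \<O> (off_c x)
    + opolar \<O> (omult \<O> (omult \<O> (off_a x) (off_b x)) (off_c x)) (oone \<O>)"

text \<open>The symmetric trilinear form and the cross product are specified by their characterising
  properties, which determine them uniquely in characteristic other than 2 and 3.\<close>

definition tri ::
    "('k::field, 'o::ab_group_add, 'm) octonion_data_scheme \<Rightarrow>
      ('k, 'o) herm3 \<Rightarrow> ('k, 'o) herm3 \<Rightarrow> ('k, 'o) herm3 \<Rightarrow> 'k"
  where "tri \<O> =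
    (THE t. (\<forall>y z. Vector_Spaces.linear (hscale \<O>) (*) (\<lambda>x. t x y z)) \<and>
            (\<forall>x y z. t x y z = t y x z \<and> t x y z = t x z y) \<and>
            (\<forall>x. t x x x = hdet \<O> x))"

definition cross ::
    "('k::field, 'o::ab_group_add, 'm) octonion_data_scheme \<Rightarrow>
      ('k, 'o) herm3 \<Rightarrow> ('k, 'o) herm3 \<Rightarrow> ('k, 'o) herm3"
  where "cross \<O> x y = (THE u. \<forall>z. 3 * tri \<O> x y z = trace_form \<O> u z)"

text \<open>The group \<open>G\<close> (as the group of its \<open>k\<close>-points) and its conjugation action on \<open>End W\<close>.\<close>

definition det_stabiliser ::
    "('k::field, 'o::ab_group_add, 'm) octonion_data_scheme \<Rightarrow> (('k, 'o) herm3 \<Rightarrow> ('k, 'o) herm3) set"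
  where "det_stabiliser \<O> =
    {g. Vector_Spaces.linear (hscale \<O>) (hscale \<O>) g \<and> bij g \<and> (\<forall>x. hdet \<O> (g x) = hdet \<O> x)}"

definition conj_act :: "('w \<Rightarrow> 'w) \<Rightarrow> ('w \<Rightarrow> 'w) \<Rightarrow> 'w \<Rightarrow> 'w"
  where "conj_act g A = g \<circ> A \<circ> inv g"


section \<open>Operators\<close>

text \<open>Operators are functions \<open>W \<Rightarrow> W\<close>, added pointwise. A triple of elements of \<open>W\<close> is given by
  a function on \<open>nat\<close>, of which only the values at 1, 2, 3 matter.\<close>

definition escale ::
    "('k::field, 'o::ab_group_add, 'm) octonion_data_scheme \<Rightarrow>
      'k \<Rightarrow> (('k, 'o) herm3 \<Rightarrow> ('k, 'o) herm3) \<Rightarrow> ('k, 'o) herm3 \<Rightarrow> ('k, 'o) herm3"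
  where "escale \<O> r A = (\<lambda>w. hscale \<O> r (A w))"

definition triple_op ::
    "('k::field, 'o::ab_group_add, 'm) octonion_data_scheme \<Rightarrow>
      ('k, 'o) herm3 \<Rightarrow> ('k, 'o) herm3 \<Rightarrow> ('k, 'o) herm3 \<Rightarrow> ('k, 'o) herm3 \<Rightarrow> ('k, 'o) herm3"
  where "triple_op \<O> x y z =
    (\<lambda>w. hscale \<O> (tri \<O> w x y) z + hscale \<O> (tri \<O> w y z) x + hscale \<O> (tri \<O> w z x) y)"

definition op_of ::
    "('k::field, 'o::ab_group_add, 'm) octonion_data_scheme \<Rightarrow>
      (nat \<Rightarrow> ('k, 'o) herm3) \<Rightarrow> ('k, 'o) herm3 \<Rightarrow> ('k, 'o) herm3"
  where "op_of \<O> a = triple_op \<O> (a 1) (a 2) (a 3)"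

text \<open>The trace of an endomorphism of a finite-dimensional space, computed in some basis.\<close>

definition endo_trace :: "('k::field \<Rightarrow> 'w::ab_group_add \<Rightarrow> 'w) \<Rightarrow> ('w \<Rightarrow> 'w) \<Rightarrow> 'k"
  where "endo_trace s A =
    (let B = (SOME B. \<not> module.dependent s B \<and> module.span s B = UNIV)
     in \<Sum>b\<in>B. module.representation s B (A b) b)"

definition sigma_A ::
    "('k::field, 'o::ab_group_add, 'm) octonion_data_scheme \<Rightarrow> (('k, 'o) herm3 \<Rightarrow> ('k, 'o) herm3) set"
  where "sigma_A \<O> = module.span (escale \<O>) (range (op_of \<O>))"

definition sigma_V ::
    "('k::field, 'o::ab_group_add, 'm) octonion_data_scheme \<Rightarrow> (('k, 'o) herm3 \<Rightarrow> ('k, 'o) herm3) set"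
  where "sigma_V \<O> = {A \<in> sigma_A \<O>. endo_trace (hscale \<O>) A = 0}"

abbreviation S3 :: "(nat \<Rightarrow> nat) set"
  where "S3 \<equiv> {p. p permutes {1, 2, 3}}"

definition f_prime ::
    "('k::field, 'o::ab_group_add, 'm) octonion_data_scheme \<Rightarrow>
      (nat \<Rightarrow> ('k, 'o) herm3) \<Rightarrow> (nat \<Rightarrow> ('k, 'o) herm3) \<Rightarrow> 'k"
  where "f_prime \<O> a b =
    (\<Sum>p\<in>S3. \<Sum>q\<in>S3. tri \<O> (a (p 1)) (b (q 2)) (b (q 3)) * tri \<O> (b (q 1)) (a (p 2)) (a (p 3)))"

definition id_decomposition ::
    "('k::field, 'o::ab_group_add, 'm) octonion_data_scheme \<Rightarrow>
      nat \<Rightarrow> (nat \<Rightarrow> nat \<Rightarrow> ('k, 'o) herm3) \<Rightarrow> bool"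
  where "id_decomposition \<O> n x \<longleftrightarrow> (\<Sum>m<n. op_of \<O> (x m)) = id"

text \<open>The right-hand side of the formula defining the product, as a function of the two triples
  and of the chosen decomposition of the identity.\<close>

definition odot2 ::
    "('k::field, 'o::ab_group_add, 'm) octonion_data_scheme \<Rightarrow>
      nat \<Rightarrow> (nat \<Rightarrow> nat \<Rightarrow> ('k, 'o) herm3) \<Rightarrow>
      (nat \<Rightarrow> ('k, 'o) herm3) \<Rightarrow> (nat \<Rightarrow> ('k, 'o) herm3) \<Rightarrow> ('k, 'o) herm3 \<Rightarrow> ('k, 'o) herm3"
  where "odot2 \<O> n x a b =
    (\<Sum>m<n. \<Sum>s\<in>S3. \<Sum>p\<in>S3. \<Sum>q\<in>S3.
      triple_op \<O>
        (cross \<O> (cross \<O> (a (p 1)) (b (q 1))) (x m (s 1)))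
        (cross \<O> (cross \<O> (a (p 2)) (a (p 3))) (cross \<O> (b (q 2)) (b (q 3))))
        (cross \<O> (x m (s 2)) (x m (s 3))))
    - escale \<O> (5 / 4 * f_prime \<O> a b) id"

definition bilinear_on ::
    "('k::field \<Rightarrow> 'v::ab_group_add \<Rightarrow> 'v) \<Rightarrow> 'v set \<Rightarrow> ('v \<Rightarrow> 'v \<Rightarrow> 'v) \<Rightarrow> bool"
  where "bilinear_on s S P \<longleftrightarrow>
    (\<forall>A\<in>S. \<forall>B\<in>S. \<forall>C\<in>S. P (A + B) C = P A C + P B C \<and> P C (A + B) = P C A + P C B) \<and>
    (\<forall>r. \<forall>A\<in>S. \<forall>B\<in>S. P (s r A) B = s r (P A B) \<and> P A (s r B) = s r (P A B))"

end

theory Submission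
  imports Defs
begin

text \<open>
  The triple product operator \<open>a1 a2 a3\<close> and the symmetrised tensor of \<open>a1 \<otimes> (a2 \<times> a3)\<close> agree, up to
  the factor 6, when \<open>W \<otimes> W\<close> is identified with \<open>End W\<close> by the trace form. The \<open>a\<^sub>i\<close>, the \<open>b\<^sub>i\<close> and the
  \<open>x\<^bsub>m,i\<^esub>\<close> enter the formula for the product only through such tensors, so that, with dual bases \<open>e\<^sub>k\<close>,
  \<open>f\<^sub>k\<close> of \<open>W\<close>, the product of \<open>A\<close> and \<open>C\<close> is
  \<open>216 \<Sum> ((A e\<^sub>i \<times> C e\<^sub>j) \<times> e\<^sub>k) (f\<^sub>i \<times> f\<^sub>j) f\<^sub>k - 5 tr (A C) id\<close>, an expression in the operators alone.
  Its trace is found from two facts: \<open>w \<mapsto> (p \<times> w) \<times> q\<close> has trace \<open>5/2 \<langle>p, q\<rangle>\<close>, and the polarised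
  adjoint identity \<open>(x \<times> x) \<times> (x \<times> x) = det x x\<close> gives
  \<open>\<Sum> (A e\<^sub>i \<times> w) \<times> f\<^sub>i = 1/4 A w + 1/12 tr A w\<close>. Together they yield
  \<open>(135 - 5 \<cdot> 27) tr (A C) + 45 tr A tr C\<close>, which vanishes on trace-zero operators.
  For equivariance, an element \<open>g\<close> of the stabiliser and its contragredient \<open>g'\<close> satisfy
  \<open>g x \<times> g y = g' (x \<times> y)\<close> and \<open>g' x \<times> g' y = g (x \<times> y)\<close>; hence \<open>g\<close> carries the formula for
  \<open>a\<close>, \<open>b\<close>, \<open>x\<close> to the one for \<open>g a\<close>, \<open>g b\<close>, \<open>g' x\<close>, and \<open>g' x\<close> again decomposes the identity.
\<close>

section \<open>Octonions\<close>

locale split_octonions =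
  fixes \<O> :: "('k::field, 'o::ab_group_add) octonion_data"
  assumes split: "split_octonion_algebra \<O>"
    and two_neq_0: "(2::'k) \<noteq> 0"
begin

abbreviation osc (infixr "\<cdot>" 75) where "r \<cdot> x \<equiv> oscale \<O> r x"
abbreviation om (infixl "\<odot>" 70) where "x \<odot> y \<equiv> omult \<O> x y"
abbreviation "\<e> \<equiv> oone \<O>"
abbreviation "N \<equiv> onorm \<O>"
abbreviation "B \<equiv> opolar \<O>"
abbreviation "cj \<equiv> oconj \<O>"

sublocale oct: vector_space "oscale \<O>"
  using split by (simp add: split_octonion_algebra_def)

lemma linear_mult_left: "Vector_Spaces.linear (oscale \<O>) (oscale \<O>) (\<lambda>y. x \<odot> y)"
  and linear_mult_right: "Vector_Spaces.linear (oscale \<O>) (oscale \<O>) (\<lambda>x. x \<odot> y)"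
  and linear_polar_left: "Vector_Spaces.linear (oscale \<O>) (*) (\<lambda>x. B x y)"
  and mult_one_left [simp]: "\<e> \<odot> x = x"
  and mult_one_right [simp]: "x \<odot> \<e> = x"
  and onorm_scale: "N (r \<cdot> x) = r ^ 2 * N x"
  and onorm_mult: "N (x \<odot> y) = N x * N y"
  and polar_nondegenerate: "(\<And>y. B x y = 0) \<Longrightarrow> x = 0"
  using split by (auto simp: split_octonion_algebra_def)

lemma polar_commute: "B x y = B y x"
  by (simp add: opolar_def add.commute)

lemmas mult_right_simps =
  module_hom.add[OF linear_mult_left[THEN module_hom_linearI]]
  module_hom.scale[OF linear_mult_left[THEN module_hom_linearI]]
  module_hom.diff[OF linear_mult_left[THEN module_hom_linearI]]
  module_hom.neg[OF linear_mult_left[THEN module_hom_linearI]]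
  module_hom.zero[OF linear_mult_left[THEN module_hom_linearI]]

lemmas mult_left_simps =
  module_hom.add[OF linear_mult_right[THEN module_hom_linearI]]
  module_hom.scale[OF linear_mult_right[THEN module_hom_linearI]]
  module_hom.diff[OF linear_mult_right[THEN module_hom_linearI]]
  module_hom.neg[OF linear_mult_right[THEN module_hom_linearI]]
  module_hom.zero[OF linear_mult_right[THEN module_hom_linearI]]

lemmas polar_left_simps =
  module_hom.add[OF linear_polar_left[THEN module_hom_linearI]]
  module_hom.scale[OF linear_polar_left[THEN module_hom_linearI]]
  module_hom.diff[OF linear_polar_left[THEN module_hom_linearI]]
  module_hom.neg[OF linear_polar_left[THEN module_hom_linearI]]
  module_hom.zero[OF linear_polar_left[THEN module_hom_linearI]]
  module_hom.sum[OF linear_polar_left[THEN module_hom_linearI]]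

lemma polar_right_simps:
  "B z (x + y) = B z x + B z y" "B z (r \<cdot> x) = r * B z x" "B z (x - y) = B z x - B z y"
  "B z (- x) = - B z x" "B z 0 = 0" "B z (sum g I) = (\<Sum>i\<in>I. B z (g i))"
  by (simp_all add: polar_commute[of z] polar_left_simps)

lemmas octonion_simps = mult_right_simps mult_left_simps polar_left_simps polar_right_simps

lemma octonion_eqI: "(\<And>z. B x z = B y z) \<Longrightarrow> x = y"
  using polar_nondegenerate[of "x - y"] by (simp add: octonion_simps)

lemma onorm_add: "N (x + y) = N x + N y + B x y"
  by (simp add: opolar_def)

lemma onorm_uminus: "N (- x) = N x"
  using onorm_scale[of "-1" x] by simp

lemma onorm_diff: "N (x - y) = N x + N y - B x y"
  using onorm_add[of x "- y"] by (simp add: onorm_uminus octonion_simps)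

lemma polar_self: "B x x = 2 * N x"
proof -
  have "x + x = 2 \<cdot> x"
    using oct.scale_left_distrib[of 1 1 x] by simp
  then show ?thesis
    by (simp add: opolar_def onorm_scale)
qed

text \<open>If \<open>N\<close> vanished identically, so would \<open>B\<close>, and nondegeneracy
  would leave only the zero vector, although the isotropy clause provides a nonzero one. So some
  \<open>N x\<close> is nonzero and cancels in
  \<open>N (\<e> \<odot> x) = N \<e> * N x\<close>.\<close>

lemma onorm_one [simp]: "N \<e> = 1"
proof -
  obtain x where x: "N x \<noteq> 0"
  proof (rule ccontr)
    assume "\<not> thesis"
    then have "N x = 0" for x using that by blast
    then have "B x y = 0" for x y by (simp add: opolar_def)
    then have "x = 0" for x :: 'o by (rule polar_nondegenerate)
    moreover have "\<exists>x::'o. x \<noteq> 0" using split by (auto simp: split_octonion_algebra_def)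
    ultimately show False by auto
  qed
  then show ?thesis using onorm_mult[of \<e> x] by simp
qed

lemma one_neq_zero: "\<e> \<noteq> 0"
  using onorm_one onorm_scale[of 0 0]
  by (metis oct.scale_zero_left power_zero_numeral mult_zero_left zero_neq_one)

section \<open>The linearised composition law and the octonion identities that follow from
  it\<close>

lemma polar_mult_left: "B (x \<odot> y) (x \<odot> z) = N x * B y z"
  using onorm_mult[of x "y + z"] by (simp add: octonion_simps onorm_add onorm_mult algebra_simps)

lemma polar_mult_right: "B (x \<odot> y) (z \<odot> y) = B x z * N y"
  using onorm_mult[of "x + z" y] by (simp add: octonion_simps onorm_add onorm_mult algebra_simps)

text \<open>Linearising \<open>polar_mult_left\<close> in its first factor completes the
  polarisation of the composition law. The two adjoint rules below are its instances with one factor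
  equal to the unit.\<close>

lemma polar_exchange: "B (x \<odot> y) (z \<odot> w) + B (x \<odot> w) (z \<odot> y) = B x z * B y w"
  using polar_mult_left[of "x + z" y w]
  by (simp add: octonion_simps onorm_add polar_mult_left algebra_simps polar_commute)

lemma conj_simps:
  "cj (x + y) = cj x + cj y" "cj (r \<cdot> x) = r \<cdot> cj x" "cj (x - y) = cj x - cj y"
  "cj (- x) = - cj x" "cj 0 = 0"
  by (simp_all add: oconj_def octonion_simps oct.scale_left_distrib oct.scale_right_diff_distrib
        oct.scale_left_diff_distrib)

lemma polar_one_one: "B \<e> \<e> = 2"
  by (simp add: polar_self)

lemma conj_conj [simp]: "cj (cj x) = x"
  by (simp add: oconj_def octonion_simps polar_one_one oct.scale_left_diff_distrib
      flip: oct.scale_left_distrib)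

lemma polar_conj: "B (cj x) (cj y) = B x y"
  by (simp add: oconj_def octonion_simps polar_one_one polar_commute algebra_simps)

lemma onorm_conj [simp]: "N (cj x) = N x"
  using polar_conj[of x x] two_neq_0 by (simp add: polar_self)

lemma polar_adjoint_left: "B (x \<odot> y) z = B y (cj x \<odot> z)"
  using polar_exchange[of x y \<e> z]
  by (simp add: oconj_def octonion_simps algebra_simps polar_commute)

lemma polar_adjoint_right: "B (x \<odot> y) z = B x (z \<odot> cj y)"
  using polar_exchange[of x y z \<e>]
  by (simp add: oconj_def octonion_simps algebra_simps polar_commute)

lemma conj_mult: "cj (x \<odot> y) = cj y \<odot> cj x"
proof (rule octonion_eqI)
  fix z
  have "B (cj (x \<odot> y)) z = B (x \<odot> y) (cj z)"
    by (metis polar_conj conj_conj)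
  also have "\<dots> = B (y \<odot> z) (cj x)"
    by (metis polar_adjoint_left polar_adjoint_right conj_conj polar_commute)
  also have "\<dots> = B (cj y \<odot> cj x) z"
    by (metis polar_adjoint_left conj_conj polar_commute)
  finally show "B (cj (x \<odot> y)) z = B (cj y \<odot> cj x) z" .
qed

lemma conj_mult_mult: "cj x \<odot> (x \<odot> y) = N x \<cdot> y"
  by (rule octonion_eqI)
    (metis polar_adjoint_left conj_conj polar_mult_left polar_left_simps(2))

lemma mult_mult_conj: "(y \<odot> x) \<odot> cj x = N x \<cdot> y"
  by (rule octonion_eqI)
    (metis polar_adjoint_right conj_conj polar_mult_right polar_left_simps(2) mult.commute)

lemma mult_conj_mult: "x \<odot> (cj x \<odot> y) = N x \<cdot> y"
  using conj_mult_mult[of "cj x"] by simp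

lemma mult_conj_add: "x \<odot> cj y + y \<odot> cj x = B x y \<cdot> \<e>"
  using mult_mult_conj[of \<e> "x + y"] mult_mult_conj[of \<e> x] mult_mult_conj[of \<e> y]
  by (simp add: conj_simps octonion_simps onorm_add oct.scale_left_distrib algebra_simps)

lemma conj_mult_add: "cj x \<odot> y + cj y \<odot> x = B x y \<cdot> \<e>"
  using mult_conj_add[of "cj x" "cj y"] by (simp add: polar_conj)

text \<open>This is the Moufang identity (ab)(ca) = a(bc)a, with the right-hand side written by the
  composition algebra formula for aya at y = bc. It supplies the off-diagonal entries in
  \<open>adjoint_identity\<close>.\<close>

lemma middle_moufang:
  "(a \<odot> b) \<odot> (c \<odot> a) = B a (cj (b \<odot> c)) \<cdot> a - N a \<cdot> cj (b \<odot> c)"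
proof (rule octonion_eqI)
  fix z
  have "B ((a \<odot> b) \<odot> (c \<odot> a)) z = B (a \<odot> b) (z \<odot> cj (c \<odot> a))"
    by (rule polar_adjoint_right)
  also have "\<dots> = B a z * B b (cj (c \<odot> a)) - B (a \<odot> cj (c \<odot> a)) (z \<odot> b)"
    using polar_exchange[of a b z "cj (c \<odot> a)"] by (simp add: algebra_simps)
  also have "a \<odot> cj (c \<odot> a) = N a \<cdot> cj c"
    by (simp add: conj_mult mult_conj_mult)
  also have "B (N a \<cdot> cj c) (z \<odot> b) = N a * B (cj (b \<odot> c)) z"
    by (simp add: octonion_simps conj_mult) (metis polar_adjoint_right polar_commute)
  also have "B b (cj (c \<odot> a)) = B a (cj (b \<odot> c))"
    by (metis conj_mult conj_conj polar_adjoint_left polar_adjoint_right polar_commute)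
  finally show "B ((a \<odot> b) \<odot> (c \<odot> a)) z
      = B (B a (cj (b \<odot> c)) \<cdot> a - N a \<cdot> cj (b \<odot> c)) z"
    by (simp add: octonion_simps mult.commute)
qed

lemma polar_cyclic: "B (cj (a \<odot> b)) c = B (cj (b \<odot> c)) a"
  by (metis conj_mult polar_adjoint_left polar_adjoint_right polar_commute polar_conj conj_conj)

lemma polar_mult_one: "B ((a \<odot> b) \<odot> c) \<e> = B (cj (a \<odot> b)) c"
  by (metis polar_adjoint_left mult_one_right polar_commute)

text \<open>The map \<open>?F\<close>, which records the pairings of \<open>x\<close> with a basis
  \<open>I\<close>, is injective by nondegeneracy, hence surjective in finite dimension. Preimages
  of the basis vectors form the dual family \<open>d\<close>.\<close>

lemma dual_basis:
  obtains I :: "'o set" and d where "finite I" "card I = 8"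
    "\<And>x. x = (\<Sum>b\<in>I. B x (d b) \<cdot> b)"
    "\<And>b. b \<in> I \<Longrightarrow> B b (d b) = 1"
proof -
  have dim: "oct.dim UNIV = 8"
    using split by (simp add: split_octonion_algebra_def)
  obtain I where I: "oct.independent I" "oct.span I = UNIV" "card I = 8"
    using oct.basis_exists[of UNIV] dim by (metis top.extremum_unique)
  have fin: "finite I" using I(3) card_ge_0_finite[of I] by simp
  interpret fd: finite_dimensional_vector_space "oscale \<O>" I
    by unfold_locales (use I fin in auto)
  let ?F = "\<lambda>x. \<Sum>b\<in>I. B b x \<cdot> b"
  have lin: "Vector_Spaces.linear (oscale \<O>) (oscale \<O>) ?F"
    by unfold_locales
      (simp_all add: octonion_simps oct.scale_left_distrib sum.distrib oct.scale_sum_right)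
  have coord: "oct.representation I y b = r b"
    if "y = (\<Sum>b\<in>I. r b \<cdot> b)" "b \<in> I" for y r b
  proof -
    let ?r = "\<lambda>b. if b \<in> I then r b else 0"
    have "(\<Sum>b | ?r b \<noteq> 0. ?r b \<cdot> b) = (\<Sum>b\<in>I. r b \<cdot> b)"
      by (rule sum.mono_neutral_cong_left) (use fin in auto)
    moreover have "finite {b. ?r b \<noteq> 0}"
      by (rule finite_subset[OF _ fin]) auto
    ultimately have "oct.representation I y = ?r"
      using that I(1,2) by (intro oct.representation_eqI) (auto split: if_splits)
    then show ?thesis using that by simp
  qed
  have "inj ?F"
  proof -
    have ker: "x = 0" if "?F x = 0" for x
    proof (rule polar_nondegenerate)
      have z: "B b x = 0" if "b \<in> I" for b
        using oct.independentD[OF I(1) fin order_refl \<open>?F x = 0\<close> that] .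
      fix y
      have "y = (\<Sum>b\<in>I. oct.representation I y b \<cdot> b)"
        using oct.sum_representation_eq[of I y I] I fin by simp
      then have "B y x = (\<Sum>b\<in>I. oct.representation I y b * B b x)"
        by (metis (no_types, lifting) polar_left_simps(2,6) sum.cong)
      then show "B x y = 0" using z by (simp add: polar_commute)
    qed
    show ?thesis
    proof (rule injI)
      fix x y assume "?F x = ?F y"
      then have "?F (x - y) = 0"
        by (simp add: octonion_simps oct.scale_left_diff_distrib sum_subtractf)
      then show "x = y" using ker[of "x - y"] by simp
    qed
  qed
  then have surj: "surj ?F"
    using fd.linear_inj_imp_surj[OF lin] by blast
  define d where "d b = (SOME x. ?F x = b)" for b
  have d: "?F (d b) = b" for b
  proof -
    obtain x where "b = ?F x" using surjD[OF surj, of b] by blast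
    then show ?thesis unfolding d_def by (intro someI[of "\<lambda>x. ?F x = b" x]) simp
  qed
  have delta: "B c (d b) = (if c = b then 1 else 0)" if "b \<in> I" "c \<in> I" for b c
    using coord[of b "\<lambda>c. B c (d b)" c] d[of b] that oct.representation_basis[OF I(1), of b]
    by simp
  have "x = (\<Sum>b\<in>I. B x (d b) \<cdot> b)" for x
  proof -
    have x: "x = (\<Sum>b\<in>I. oct.representation I x b \<cdot> b)"
      using oct.sum_representation_eq[of I x I] I fin by simp
    have "B x (d b) = oct.representation I x b" if "b \<in> I" for b
    proof -
      have "B x (d b) = (\<Sum>c\<in>I. oct.representation I x c * B c (d b))"
        by (subst x) (simp add: octonion_simps)
      also have "\<dots> = (\<Sum>c\<in>I. if c = b then oct.representation I x c else 0)"
        using that by (intro sum.cong) (auto simp: delta)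
      finally show ?thesis using that fin by simp
    qed
    then have "(\<Sum>b\<in>I. B x (d b) \<cdot> b) = (\<Sum>b\<in>I. oct.representation I x b \<cdot> b)"
      by (intro sum.cong) simp_all
    then show ?thesis using x by simp
  qed
  then show ?thesis
    using that[of I d] fin I(3) delta by auto
qed

end

section \<open>The Albert algebra\<close>

lemma herm3_eqI:
  "diag1 x = diag1 y \<Longrightarrow> diag2 x = diag2 y \<Longrightarrow> diag3 x = diag3 y \<Longrightarrow>
    off_a x = off_a y \<Longrightarrow> off_b x = off_b y \<Longrightarrow> off_c x = off_c y \<Longrightarrow> x = y"
  by (simp add: herm3.expand)

lemma herm3_components [simp]:
  "diag1 0 = 0" "diag2 0 = 0" "diag3 0 = 0" "off_a 0 = 0" "off_b 0 = 0" "off_c 0 = 0"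
  "diag1 (x + y) = diag1 x + diag1 y" "diag2 (x + y) = diag2 x + diag2 y"
  "diag3 (x + y) = diag3 x + diag3 y"
  "off_a (x + y) = off_a x + off_a y" "off_b (x + y) = off_b x + off_b y"
  "off_c (x + y) = off_c x + off_c y"
  "diag1 (- x) = - diag1 x" "diag2 (- x) = - diag2 x" "diag3 (- x) = - diag3 x"
  "off_a (- x) = - off_a x" "off_b (- x) = - off_b x" "off_c (- x) = - off_c x"
  "diag1 (x - y) = diag1 x - diag1 y" "diag2 (x - y) = diag2 x - diag2 y"
  "diag3 (x - y) = diag3 x - diag3 y"
  "off_a (x - y) = off_a x - off_a y" "off_b (x - y) = off_b x - off_b y"
  "off_c (x - y) = off_c x - off_c y"
  by (simp_all add: zero_herm3_def plus_herm3_def uminus_herm3_def minus_herm3_def)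

lemma hscale_components [simp]:
  "diag1 (hscale \<O> r x) = r * diag1 x" "diag2 (hscale \<O> r x) = r * diag2 x"
  "diag3 (hscale \<O> r x) = r * diag3 x"
  "off_a (hscale \<O> r x) = oscale \<O> r (off_a x)" "off_b (hscale \<O> r x) = oscale \<O> r (off_b x)"
  "off_c (hscale \<O> r x) = oscale \<O> r (off_c x)"
  by (simp_all add: hscale_def)

text \<open>Excluding 2 and 3 lets 6 be inverted when cubic forms are polarised; the infinitely many
  scalars serve the density argument in \<open>symmetric_bilinear_eq_0\<close>.\<close>

locale albert_algebra = split_octonions \<O>
  for \<O> :: "('k::field, 'o::ab_group_add) octonion_data" +
  assumes three_neq_0: "(3::'k) \<noteq> 0"
    and infinite_field: "infinite (UNIV :: 'k set)"
begin

abbreviation hsc (infixr "*\<^sub>W" 75) where "r *\<^sub>W x \<equiv> hscale \<O> r x"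
abbreviation "T \<equiv> trace_form \<O>"
abbreviation cr (infixl "\<times>\<times>" 70) where "x \<times>\<times> y \<equiv> cross \<O> x y"
abbreviation "tr3 \<equiv> tri \<O>"
abbreviation "Dt \<equiv> hdet \<O>"

sublocale alb: vector_space "hscale \<O>"
  by unfold_locales
    (auto intro!: herm3_eqI simp: algebra_simps oct.scale_right_distrib oct.scale_left_distrib)

section \<open>The Jordan product and the trace form in coordinates\<close>

lemma two_powers_neq_0: "(4::'k) \<noteq> 0" "(8::'k) \<noteq> 0"
  using power_not_zero[OF two_neq_0, of 2] power_not_zero[OF two_neq_0, of 3] by simp_all

text \<open>To evaluate the description in \<open>jordan\<close>, the symmetrised matrix product
  must be hermitian and \<open>hmat\<close> injective. The diagonal entries are multiples of the
  unit by \<open>mult_conj_add\<close> and \<open>conj_mult_add\<close>.\<close>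

lemma jordan_eq:
  "jordan \<O> x y = Herm3
    (diag1 x * diag1 y + (B (off_b x) (off_b y) + B (off_c x) (off_c y)) / 2)
    (diag2 x * diag2 y + (B (off_a x) (off_a y) + B (off_c x) (off_c y)) / 2)
    (diag3 x * diag3 y + (B (off_a x) (off_a y) + B (off_b x) (off_b y)) / 2)
    ((1/2) \<cdot> ((diag2 x + diag3 x) \<cdot> off_a y + (diag2 y + diag3 y) \<cdot> off_a x
      + cj (off_b x \<odot> off_c y) + cj (off_b y \<odot> off_c x)))
    ((1/2) \<cdot> ((diag3 x + diag1 x) \<cdot> off_b y + (diag3 y + diag1 y) \<cdot> off_b x
      + cj (off_c x \<odot> off_a y) + cj (off_c y \<odot> off_a x)))
    ((1/2) \<cdot> ((diag1 x + diag2 x) \<cdot> off_c y + (diag1 y + diag2 y) \<cdot> off_c x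
      + cj (off_a x \<odot> off_b y) + cj (off_a y \<odot> off_b x)))" (is "_ = ?z")
proof -
  have one: "cj \<e> = \<e>"
    by (simp add: oconj_def polar_one_one flip: oct.scale_left_diff_distrib)
      (metis add_diff_cancel_right' oct.scale_left_distrib oct.scale_one one_add_one)
  \<comment> \<open>As a general rewrite rule this would loop; it is used below only in the fixed
    order \<open>off_a y\<close>, \<open>off_a x\<close>, and likewise for the other two
    entries.\<close>
  have comm: "u \<odot> cj v = B u v \<cdot> \<e> - v \<odot> cj u" "cj u \<odot> v = B u v \<cdot> \<e> - cj v \<odot> u" for u v
    using mult_conj_add[of u v] conj_mult_add[of u v] by (simp_all add: algebra_simps)
  have inj: "z = z'" if "hmat \<O> z = hmat \<O> z'" for z z'
    using that one_neq_zero
    by (intro herm3_eqI) (simp_all add: hmat_def vec_eq_iff forall_3 vector_3 conj_simps)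
  have eq: "hmat \<O> ?z = (\<chi> i j. (1/2) \<cdot>
      ((omat_mult \<O> (hmat \<O> x) (hmat \<O> y) + omat_mult \<O> (hmat \<O> y) (hmat \<O> x)) $ i $ j))"
    apply (simp add: hmat_def omat_mult_def vec_eq_iff forall_3 vector_3 sum_3 conj_simps
        octonion_simps oct.scale_right_distrib oct.scale_left_distrib add_divide_distrib conj_mult)
    apply (intro conjI octonion_eqI;
        simp add: octonion_simps comm[of "off_a y" "off_a x"] comm[of "off_b y" "off_b x"]
          comm[of "off_c y" "off_c x"] polar_commute field_simps two_neq_0)
    done
  show ?thesis
    unfolding jordan_def by (rule the_equality, rule eq, rule inj, simp only: eq)
qed

lemma trace_form_eq:
  "T x y = diag1 x * diag1 y + diag2 x * diag2 y + diag3 x * diag3 y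
    + B (off_a x) (off_a y) + B (off_b x) (off_b y) + B (off_c x) (off_c y)"
  using two_neq_0 two_powers_neq_0 by (simp add: trace_form_def htrace_def jordan_eq field_simps)

lemma trace_form_commute: "T x y = T y x"
  by (simp add: trace_form_eq polar_commute algebra_simps)

lemma linear_trace_form: "Vector_Spaces.linear (hscale \<O>) (*) (\<lambda>x. T x y)"
  by unfold_locales (simp_all add: trace_form_eq octonion_simps algebra_simps)

lemmas trace_form_left_simps =
  module_hom.add[OF linear_trace_form[THEN module_hom_linearI]]
  module_hom.scale[OF linear_trace_form[THEN module_hom_linearI]]
  module_hom.diff[OF linear_trace_form[THEN module_hom_linearI]]
  module_hom.neg[OF linear_trace_form[THEN module_hom_linearI]]
  module_hom.zero[OF linear_trace_form[THEN module_hom_linearI]]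
  module_hom.sum[OF linear_trace_form[THEN module_hom_linearI]]

lemma trace_form_right_simps:
  "T z (x + y) = T z x + T z y" "T z (r *\<^sub>W x) = r * T z x" "T z (x - y) = T z x - T z y"
  "T z (- x) = - T z x" "T z 0 = 0" "T z (sum g I) = (\<Sum>i\<in>I. T z (g i))"
  by (simp_all add: trace_form_commute[of z] trace_form_left_simps)

lemmas trace_form_simps = trace_form_left_simps trace_form_right_simps

lemma trace_form_eqI:
  assumes "\<And>z. T x z = T y z"
  shows "x = y"
proof (rule herm3_eqI)
  show "diag1 x = diag1 y" using assms[of "Herm3 1 0 0 0 0 0"]
    by (simp add: trace_form_eq octonion_simps)
  show "diag2 x = diag2 y" using assms[of "Herm3 0 1 0 0 0 0"]
    by (simp add: trace_form_eq octonion_simps)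
  show "diag3 x = diag3 y" using assms[of "Herm3 0 0 1 0 0 0"]
    by (simp add: trace_form_eq octonion_simps)
  show "off_a x = off_a y" using assms[of "Herm3 0 0 0 _ 0 0"]
    by (intro octonion_eqI) (simp add: trace_form_eq octonion_simps)
  show "off_b x = off_b y" using assms[of "Herm3 0 0 0 0 _ 0"]
    by (intro octonion_eqI) (simp add: trace_form_eq octonion_simps)
  show "off_c x = off_c y" using assms[of "Herm3 0 0 0 0 0 _"]
    by (intro octonion_eqI) (simp add: trace_form_eq octonion_simps)
qed

section \<open>The cross product, the trilinear form and the adjoint identity\<close>

definition freudenthal :: "('k, 'o) herm3 \<Rightarrow> ('k, 'o) herm3 \<Rightarrow> ('k, 'o) herm3" where
  "freudenthal x y = (1 / 2) *\<^sub>W Herm3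
    (diag2 x * diag3 y + diag2 y * diag3 x - B (off_a x) (off_a y))
    (diag3 x * diag1 y + diag3 y * diag1 x - B (off_b x) (off_b y))
    (diag1 x * diag2 y + diag1 y * diag2 x - B (off_c x) (off_c y))
    (cj (off_b x \<odot> off_c y) + cj (off_b y \<odot> off_c x)
      - diag1 x \<cdot> off_a y - diag1 y \<cdot> off_a x)
    (cj (off_c x \<odot> off_a y) + cj (off_c y \<odot> off_a x)
      - diag2 x \<cdot> off_b y - diag2 y \<cdot> off_b x)
    (cj (off_a x \<odot> off_b y) + cj (off_a y \<odot> off_b x)
      - diag3 x \<cdot> off_c y - diag3 y \<cdot> off_c x)"

lemma freudenthal_commute: "freudenthal x y = freudenthal y x"
  by (simp add: freudenthal_def polar_commute algebra_simps)

text \<open>Once \<open>polar_cyclic\<close> has brought every octonion triple product into the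
  order \<open>a\<close>, \<open>b\<close>, \<open>c\<close>, the right-hand side is visibly
  symmetric in \<open>x\<close>, \<open>y\<close>, \<open>z\<close>. The factor 2 clears the 1/2 in
  \<open>freudenthal\<close>.\<close>

lemma trace_freudenthal_eq:
  "2 * T (freudenthal x y) z =
    diag1 z * (diag2 x * diag3 y + diag2 y * diag3 x - B (off_a x) (off_a y))
    + diag2 z * (diag3 x * diag1 y + diag3 y * diag1 x - B (off_b x) (off_b y))
    + diag3 z * (diag1 x * diag2 y + diag1 y * diag2 x - B (off_c x) (off_c y))
    - diag1 x * B (off_a y) (off_a z) - diag1 y * B (off_a x) (off_a z)
    - diag2 x * B (off_b y) (off_b z) - diag2 y * B (off_b x) (off_b z)
    - diag3 x * B (off_c y) (off_c z) - diag3 y * B (off_c x) (off_c z)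
    + B (cj (off_a x \<odot> off_b y)) (off_c z) + B (cj (off_a y \<odot> off_b x)) (off_c z)
    + B (cj (off_a x \<odot> off_b z)) (off_c y) + B (cj (off_a y \<odot> off_b z)) (off_c x)
    + B (cj (off_a z \<odot> off_b x)) (off_c y) + B (cj (off_a z \<odot> off_b y)) (off_c x)"
proof -
  have cyc: "B (cj (b \<odot> c)) a = B (cj (a \<odot> b)) c" "B (cj (c \<odot> a)) b = B (cj (a \<odot> b)) c"
    for a b c
    using polar_cyclic[of a b c] polar_cyclic[of b c a] by simp_all
  show ?thesis
    using two_neq_0
    unfolding freudenthal_def trace_form_left_simps
    by (simp add: trace_form_eq octonion_simps algebra_simps
        cyc[of "off_b _" "off_c _" "off_a _"] cyc(2)[of "off_c _" "off_a _" "off_b _"])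
qed

lemma trace_freudenthal_commute: "T (freudenthal x y) z = T (freudenthal x z) y"
proof -
  have "2 * T (freudenthal x y) z = 2 * T (freudenthal x z) y"
    unfolding trace_freudenthal_eq by (simp add: polar_commute algebra_simps)
  then show ?thesis using two_neq_0 by simp
qed

lemma trace_freudenthal_diag: "T (freudenthal x x) x = 3 * Dt x"
proof -
  have "2 * T (freudenthal x x) x = 2 * (3 * Dt x)"
    unfolding trace_freudenthal_eq by (simp add: hdet_def polar_self polar_mult_one algebra_simps)
  then show ?thesis using two_neq_0 by (metis mult_cancel_left)
qed

lemma linear_freudenthal: "Vector_Spaces.linear (hscale \<O>) (hscale \<O>) (\<lambda>x. freudenthal x y)"
  by unfold_locales
    (auto intro!: herm3_eqI octonion_eqI
      simp: freudenthal_def octonion_simps conj_simps algebra_simps diff_divide_distrib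
        add_divide_distrib)

text \<open>Inclusion-exclusion recovers the form from its cubic diagonal. This yields both the
  uniqueness of \<open>tri\<close> and its invariance under the stabiliser of the
  determinant.\<close>

lemma symmetric_trilinear_polarization:
  fixes t :: "'v::ab_group_add \<Rightarrow> 'v \<Rightarrow> 'v \<Rightarrow> 'k"
  assumes add: "\<And>x x' y z. t (x + x') y z = t x y z + t x' y z"
    and sym: "\<And>x y z. t x y z = t y x z" "\<And>x y z. t x y z = t x z y"
    and q: "\<And>x. q x = t x x x"
  shows "6 * t x y z = q (x + y + z) - q (x + y) - q (x + z) - q (y + z) + q x + q y + q z"
proof -
  have add': "t z (x + x') y = t z x y + t z x' y" "t z y (x + x') = t z y x + t z y x'"
    for x x' y z
    by (metis add sym)+
  have s: "t y x x = t x x y" "t x y x = t x x y" "t x y z = t z x y" "t y x z = t z x y"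
     "t x z y = t z x y" "t y z x = t z x y" "t z y x = t z x y" for x y z
    by (metis sym)+
  show ?thesis
    unfolding q add add' by (simp add: algebra_simps sym)
qed

lemma six_neq_0: "(6::'k) \<noteq> 0"
proof -
  have "(6::'k) = 2 * 3" by simp
  then show ?thesis using two_neq_0 three_neq_0 by (metis mult_eq_0_iff)
qed

text \<open>The candidate has the three characterising properties. Any other form with them takes
  the same values after multiplication by 6, by polarisation, and 6 is invertible.\<close>

lemma tri_eq_freudenthal: "tri \<O> = (\<lambda>x y z. T (freudenthal x y) z / 3)" (is "_ = ?t")
  unfolding tri_def
proof (rule the_equality)
  let ?P = "\<lambda>t. (\<forall>y z. Vector_Spaces.linear (hscale \<O>) (*) (\<lambda>x. t x y z)) \<and>
    (\<forall>x y z. t x y z = t y x z \<and> t x y z = t x z y) \<and> (\<forall>x. t x x x = Dt x)"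
  note lin = linear_freudenthal[THEN module_hom_linearI]
  show P: "?P ?t"
  proof (intro conjI allI)
    show "Vector_Spaces.linear (hscale \<O>) (*) (\<lambda>x. ?t x y z)" for y z
      by unfold_locales
        (simp_all add: module_hom.add[OF lin] module_hom.scale[OF lin] trace_form_simps
          add_divide_distrib algebra_simps)
    show "?t x y z = ?t y x z" "?t x y z = ?t x z y" for x y z
      using freudenthal_commute[of x y] trace_freudenthal_commute[of x y z] by simp_all
    show "?t x x x = Dt x" for x
      using three_neq_0 by (simp add: trace_freudenthal_diag)
  qed
  have unique: "6 * t x y z = Dt (x + y + z) - Dt (x + y) - Dt (x + z) - Dt (y + z)
      + Dt x + Dt y + Dt z" if "?P t" for t x y z
  proof (rule symmetric_trilinear_polarization)
    have "module_hom (hscale \<O>) (*) (\<lambda>x. t x y z)" for y z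
      using that module_hom_linearI by blast
    then show "t (x + x') y z = t x y z + t x' y z" for x x' y z
      by (rule module_hom.add)
  qed (use that in \<open>auto\<close>)
  fix t assume t: "?P t"
  have "6 * t x y z = 6 * ?t x y z" for x y z
    using unique[OF t, of x y z] unique[OF P, of x y z] by (rule trans_sym)
  then show "t = ?t" using six_neq_0 by (intro ext) (metis mult_cancel_left)
qed

lemma cross_eq_freudenthal: "x \<times>\<times> y = freudenthal x y"
  unfolding cross_def tri_eq_freudenthal
proof (rule the_equality)
  show "\<forall>z. 3 * (T (freudenthal x y) z / 3) = T (freudenthal x y) z"
    using three_neq_0 by simp
  show "u = freudenthal x y" if "\<forall>z. 3 * (T (freudenthal x y) z / 3) = T u z" for u
    using that three_neq_0 by (intro trace_form_eqI) simp
qed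

lemma cross_commute: "x \<times>\<times> y = y \<times>\<times> x"
  by (simp add: cross_eq_freudenthal freudenthal_commute)

lemma linear_cross: "Vector_Spaces.linear (hscale \<O>) (hscale \<O>) (\<lambda>x. x \<times>\<times> y)"
  using linear_freudenthal by (simp add: cross_eq_freudenthal)

lemmas cross_left_simps =
  module_hom.add[OF linear_cross[THEN module_hom_linearI]]
  module_hom.scale[OF linear_cross[THEN module_hom_linearI]]
  module_hom.diff[OF linear_cross[THEN module_hom_linearI]]
  module_hom.neg[OF linear_cross[THEN module_hom_linearI]]
  module_hom.zero[OF linear_cross[THEN module_hom_linearI]]
  module_hom.sum[OF linear_cross[THEN module_hom_linearI]]

lemma cross_right_simps:
  "z \<times>\<times> (x + y) = z \<times>\<times> x + z \<times>\<times> y" "z \<times>\<times> (r *\<^sub>W x) = r *\<^sub>W (z \<times>\<times> x)"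
  "z \<times>\<times> (x - y) = z \<times>\<times> x - z \<times>\<times> y" "z \<times>\<times> (- x) = - (z \<times>\<times> x)" "z \<times>\<times> 0 = 0"
  "z \<times>\<times> (sum g I) = (\<Sum>i\<in>I. z \<times>\<times> g i)"
  by (simp_all add: cross_commute[of z] cross_left_simps)

lemmas cross_simps = cross_left_simps cross_right_simps

lemma trace_cross: "T (x \<times>\<times> y) z = 3 * tr3 x y z"
  using three_neq_0 by (simp add: cross_eq_freudenthal tri_eq_freudenthal)

lemma trace_cross_right: "T z (x \<times>\<times> y) = 3 * tr3 x y z"
  by (subst trace_form_commute) (rule trace_cross)

lemma tri_commute: "tr3 x y z = tr3 y x z" "tr3 x y z = tr3 x z y"
  using freudenthal_commute[of x y] trace_freudenthal_commute[of x y z]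
  by (simp_all add: tri_eq_freudenthal)

lemma tri_diag: "tr3 x x x = Dt x"
  using three_neq_0 by (simp add: tri_eq_freudenthal trace_freudenthal_diag)

lemma tri_simps:
  "tr3 (x + x') y z = tr3 x y z + tr3 x' y z" "tr3 (r *\<^sub>W x) y z = r * tr3 x y z"
  "tr3 (x - x') y z = tr3 x y z - tr3 x' y z" "tr3 0 y z = 0"
  "tr3 y (x + x') z = tr3 y x z + tr3 y x' z" "tr3 y (r *\<^sub>W x) z = r * tr3 y x z"
  "tr3 y (x - x') z = tr3 y x z - tr3 y x' z" "tr3 y 0 z = 0"
  "tr3 y z (x + x') = tr3 y z x + tr3 y z x'" "tr3 y z (r *\<^sub>W x) = r * tr3 y z x"
  "tr3 y z (x - x') = tr3 y z x - tr3 y z x'" "tr3 y z 0 = 0"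
  using three_neq_0
  by (simp_all add: tri_eq_freudenthal cross_simps trace_form_simps add_divide_distrib
      diff_divide_distrib flip: cross_eq_freudenthal)

text \<open>This is the Freudenthal adjoint of \<open>x\<close>, the analogue of the adjugate
  matrix; the 1/2 in \<open>freudenthal\<close> makes it come out without a factor 2.\<close>

lemma cross_self:
  "x \<times>\<times> x = Herm3 (diag2 x * diag3 x - N (off_a x)) (diag3 x * diag1 x - N (off_b x))
    (diag1 x * diag2 x - N (off_c x)) (cj (off_b x \<odot> off_c x) - diag1 x \<cdot> off_a x)
    (cj (off_c x \<odot> off_a x) - diag2 x \<cdot> off_b x)
    (cj (off_a x \<odot> off_b x) - diag3 x \<cdot> off_c x)"
  using two_neq_0 two_powers_neq_0
  by (intro herm3_eqI octonion_eqI; simp add: cross_eq_freudenthal freudenthal_def polar_self)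
    (simp_all add: octonion_simps field_simps)

text \<open>Multiplicativity of \<open>N\<close> settles the diagonal entries. Off the diagonal, the
  product of two conjugated products is opened by \<open>middle_moufang\<close>, and the mixed terms
  collapse by \<open>cancel\<close>.\<close>

lemma adjoint_identity: "(x \<times>\<times> x) \<times>\<times> (x \<times>\<times> x) = Dt x *\<^sub>W x"
proof -
  let ?a = "off_a x" and ?b = "off_b x" and ?c = "off_c x"
  let ?D = "B (cj (?a \<odot> ?b)) ?c"
  have D: "Dt x = diag1 x * diag2 x * diag3 x - diag1 x * N ?a - diag2 x * N ?b
      - diag3 x * N ?c + ?D"
    by (simp add: hdet_def polar_mult_one)
  have cyc: "B ?a (cj (?b \<odot> ?c)) = ?D" "B ?b (cj (?c \<odot> ?a)) = ?D" "B ?c (cj (?a \<odot> ?b)) = ?D"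
    "B (cj (?b \<odot> ?c)) ?a = ?D" "B (cj (?c \<odot> ?a)) ?b = ?D"
    using polar_cyclic[of ?a ?b ?c] polar_cyclic[of ?b ?c ?a] by (simp_all add: polar_commute)
  have moufang: "cj (cj (c \<odot> a) \<odot> cj (a \<odot> b)) = B a (cj (b \<odot> c)) \<cdot> a - N a \<cdot> cj (b \<odot> c)" for a b c
    using middle_moufang[of a b c] by (simp add: conj_mult)
  have cancel: "cj (cj (c \<odot> a) \<odot> c) = N c \<cdot> a" "cj (b \<odot> cj (a \<odot> b)) = N b \<cdot> a" for a b c
    using conj_mult_mult[of c a] mult_mult_conj[of a b] by (simp_all add: conj_mult)
  show ?thesis
    by (intro herm3_eqI octonion_eqI; simp add: cross_self onorm_diff onorm_scale onorm_mult)
      (simp_all add: octonion_simps conj_simps moufang cancel cyc D onorm_mult algebra_simps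
        power2_eq_square)
qed

text \<open>The index \<open>None\<close> marks the diagonal idempotents and \<open>Some b\<close>
  the octonion entries, whence 27 = 3 * (1 + 8). The value 5/2 can be read off at
  \<open>p = q = E 1\<close>, where the sum is 1/4 + 1/4 + 8/4.\<close>

lemma dual_bases:
  obtains K :: "(nat \<times> 'o option) set" and e f where "finite K"
    "\<And>w. w = (\<Sum>k\<in>K. T w (f k) *\<^sub>W e k)"
    "(\<Sum>k\<in>K. T (e k) (f k)) = 27"
    "\<And>p q. (\<Sum>k\<in>K. T (p \<times>\<times> e k) (q \<times>\<times> f k)) = 5 / 2 * T p q"
proof -
  obtain I :: "'o set" and d where I: "finite I" "card I = 8"
    and expand: "\<And>x. x = (\<Sum>b\<in>I. B x (d b) \<cdot> b)"
    and unit: "\<And>b. b \<in> I \<Longrightarrow> B b (d b) = 1"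
    using dual_basis by metis
  define E :: "nat \<Rightarrow> ('k, 'o) herm3" where
    "E i = Herm3 (if i = 1 then 1 else 0) (if i = 2 then 1 else 0) (if i = 3 then 1 else 0) 0 0 0" for i
  define F :: "nat \<Rightarrow> 'o \<Rightarrow> ('k, 'o) herm3" where
    "F i u = Herm3 0 0 0 (if i = 1 then u else 0) (if i = 2 then u else 0) (if i = 3 then u else 0)"
    for i u
  define K where "K = {1, 2, 3::nat} \<times> insert None (Some ` I)"
  define e where "e k = (case snd k of None \<Rightarrow> E (fst k) | Some b \<Rightarrow> F (fst k) b)" for k
  define f where "f k = (case snd k of None \<Rightarrow> E (fst k) | Some b \<Rightarrow> F (fst k) (d b))" for k
  have sum_K: "(\<Sum>k\<in>K. g (e k) (f k)) =
      g (E 1) (E 1) + g (E 2) (E 2) + g (E 3) (E 3) + (\<Sum>b\<in>I. g (F 1 b) (F 1 (d b)))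
      + (\<Sum>b\<in>I. g (F 2 b) (F 2 (d b))) + (\<Sum>b\<in>I. g (F 3 b) (F 3 (d b)))"
    for g :: "('k, 'o) herm3 \<Rightarrow> ('k, 'o) herm3 \<Rightarrow> 'k"
  proof -
    have "(\<Sum>k\<in>K. g (e k) (f k)) = (\<Sum>i\<in>{1, 2, 3}. \<Sum>j\<in>insert None (Some ` I). g (e (i, j)) (f (i, j)))"
      by (simp only: K_def sum.cartesian_product) (simp add: case_prod_unfold)
    also have "\<dots> = (\<Sum>i\<in>{1, 2, 3}. g (E i) (E i) + (\<Sum>b\<in>I. g (F i b) (F i (d b))))"
      using I(1) by (simp add: e_def f_def sum.reindex image_iff)
    finally show ?thesis by (simp add: algebra_simps)
  qed
  have contract: "(\<Sum>b\<in>I. B x b * B y (d b)) = B x y" "(\<Sum>b\<in>I. B b x * B y (d b)) = B x y"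
    "(\<Sum>b\<in>I. B y (d b) * B b x) = B y x" for x y
  proof -
    show *: "(\<Sum>b\<in>I. B x b * B y (d b)) = B x y"
      by (subst (2) expand[of y]) (simp add: octonion_simps mult.commute)
    show "(\<Sum>b\<in>I. B b x * B y (d b)) = B x y"
      using * by (simp add: polar_commute)
    then show "(\<Sum>b\<in>I. B y (d b) * B b x) = B y x"
      by (simp add: polar_commute mult.commute)
  qed
  \<comment> \<open>A basis and its dual may be interchanged, because the coefficients
    \<open>B (d b) (d c)\<close> of \<open>d b\<close> in the basis are symmetric in
    \<open>b\<close> and \<open>c\<close>.\<close>
  have symm: "(\<Sum>b\<in>I. B (\<phi> (d b)) (\<psi> b)) = (\<Sum>b\<in>I. B (\<phi> b) (\<psi> (d b)))"
    if "Vector_Spaces.linear (oscale \<O>) (oscale \<O>) \<phi>" "Vector_Spaces.linear (oscale \<O>) (oscale \<O>) \<psi>"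
    for \<phi> \<psi>
  proof -
    note hom = that[THEN module_hom_linearI]
    have d: "h (d b) = (\<Sum>c\<in>I. B (d b) (d c) \<cdot> h c)"
      if "module_hom (oscale \<O>) (oscale \<O>) h" for b h
      by (subst expand[of "d b"]) (simp add: module_hom.sum[OF that] module_hom.scale[OF that])
    have "(\<Sum>b\<in>I. B (\<phi> (d b)) (\<psi> b)) = (\<Sum>b\<in>I. \<Sum>c\<in>I. B (d b) (d c) * B (\<phi> c) (\<psi> b))"
      by (simp add: d[OF hom(1)] octonion_simps)
    also have "\<dots> = (\<Sum>b\<in>I. \<Sum>c\<in>I. B (d b) (d c) * B (\<phi> b) (\<psi> c))"
      by (subst sum.swap) (simp add: polar_commute)
    also have "\<dots> = (\<Sum>b\<in>I. B (\<phi> b) (\<psi> (d b)))"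
      by (simp add: d[OF hom(2)] octonion_simps)
    finally show ?thesis .
  qed
  have eight: "(\<Sum>b\<in>I. B b (d b)) = 8"
    using I unit by simp
  have quarter: "s = 4 * t" if "s + s = t * 8" for s t :: 'k
  proof -
    have "2 * s = 2 * (4 * t)" using that unfolding mult_2 by (simp flip: distrib_left)
    then show ?thesis using two_neq_0 by (metis mult_cancel_left)
  qed
  \<comment> \<open>Summing \<open>polar_exchange\<close> over dual pairs gives this sum plus its
    copy with \<open>b\<close> and \<open>d b\<close> interchanged, equal to it by
    \<open>symm\<close>; the total is \<open>8 * B x y\<close>.\<close>
  have left: "(\<Sum>b\<in>I. B (x \<odot> b) (y \<odot> d b)) = 4 * B x y" for x y
  proof (rule quarter)
    have "(\<Sum>b\<in>I. B (x \<odot> b) (y \<odot> d b)) + (\<Sum>b\<in>I. B (x \<odot> d b) (y \<odot> b))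
        = (\<Sum>b\<in>I. B x y * B b (d b))"
      unfolding sum.distrib[symmetric] polar_exchange ..
    then show "(\<Sum>b\<in>I. B (x \<odot> b) (y \<odot> d b)) + (\<Sum>b\<in>I. B (x \<odot> b) (y \<odot> d b)) = B x y * 8"
      by (simp add: symm[OF linear_mult_left linear_mult_left] sum_distrib_left[symmetric] eight)
  qed
  have right: "(\<Sum>b\<in>I. B (b \<odot> x) (d b \<odot> y)) = 4 * B x y" for x y
  proof (rule quarter)
    have "(\<Sum>b\<in>I. B (b \<odot> x) (d b \<odot> y)) + (\<Sum>b\<in>I. B (b \<odot> y) (d b \<odot> x))
        = (\<Sum>b\<in>I. B b (d b) * B x y)"
      unfolding sum.distrib[symmetric] polar_exchange ..
    moreover have "(\<Sum>b\<in>I. B (b \<odot> y) (d b \<odot> x)) = (\<Sum>b\<in>I. B (b \<odot> x) (d b \<odot> y))"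
      using symm[OF linear_mult_right linear_mult_right, of x y] by (simp add: polar_commute)
    ultimately show "(\<Sum>b\<in>I. B (b \<odot> x) (d b \<odot> y)) + (\<Sum>b\<in>I. B (b \<odot> x) (d b \<odot> y)) = B x y * 8"
      by (simp add: sum_distrib_right[symmetric] eight)
  qed
  show ?thesis
  proof
    show "finite K" using I by (simp add: K_def)
    show "w = (\<Sum>k\<in>K. T w (f k) *\<^sub>W e k)" for w
    proof (rule trace_form_eqI)
      fix z
      have "T (\<Sum>k\<in>K. T w (f k) *\<^sub>W e k) z = (\<Sum>k\<in>K. T w (f k) * T (e k) z)"
        by (simp add: trace_form_simps)
      also have "\<dots> = T w z"
        by (subst sum_K) (simp add: E_def F_def trace_form_eq octonion_simps contract)
      finally show "T w z = T (\<Sum>k\<in>K. T w (f k) *\<^sub>W e k) z" ..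
    qed
    show "(\<Sum>k\<in>K. T (e k) (f k)) = 27"
      by (subst sum_K) (simp add: E_def F_def trace_form_eq octonion_simps eight)
    show "(\<Sum>k\<in>K. T (p \<times>\<times> e k) (q \<times>\<times> f k)) = 5 / 2 * T p q" for p q
    proof -
      \<comment> \<open>Each of the two cross products carries a factor 1/2; the 4 clears both
        before the entries are expanded.\<close>
      have "(\<Sum>k\<in>K. 4 * T (p \<times>\<times> e k) (q \<times>\<times> f k)) = 4 * (5 / 2 * T p q)"
      proof -
        have half: "4 * T (freudenthal p u) (freudenthal q v)
            = T (2 *\<^sub>W freudenthal p u) (2 *\<^sub>W freudenthal q v)" for u v
          by (simp add: trace_form_simps)
        have two: "2 *\<^sub>W freudenthal u v = Herm3
            (diag2 u * diag3 v + diag2 v * diag3 u - B (off_a u) (off_a v))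
            (diag3 u * diag1 v + diag3 v * diag1 u - B (off_b u) (off_b v))
            (diag1 u * diag2 v + diag1 v * diag2 u - B (off_c u) (off_c v))
            (cj (off_b u \<odot> off_c v) + cj (off_b v \<odot> off_c u)
              - diag1 u \<cdot> off_a v - diag1 v \<cdot> off_a u)
            (cj (off_c u \<odot> off_a v) + cj (off_c v \<odot> off_a u)
              - diag2 u \<cdot> off_b v - diag2 v \<cdot> off_b u)
            (cj (off_a u \<odot> off_b v) + cj (off_a v \<odot> off_b u)
              - diag3 u \<cdot> off_c v - diag3 v \<cdot> off_c u)" for u v
          using two_neq_0 by (simp add: freudenthal_def)
        show ?thesis
          unfolding cross_eq_freudenthal half two
          using two_neq_0
          by (subst sum_K; simp add: E_def F_def trace_form_eq octonion_simps conj_simps polar_conj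
              sum.distrib sum_distrib_left[symmetric] contract left right eight)
      qed
      then show ?thesis
        unfolding sum_distrib_left[symmetric] mult_left_cancel[OF two_powers_neq_0(1)] .
    qed
  qed
qed

end

section \<open>Operators and dual bases\<close>

lemma sum_S3:
  fixes g :: "nat \<Rightarrow> nat \<Rightarrow> nat \<Rightarrow> 'a::comm_monoid_add"
  shows "(\<Sum>p\<in>S3. g (p 1) (p 2) (p 3)) =
    g 1 2 3 + g 1 3 2 + g 2 1 3 + g 2 3 1 + g 3 1 2 + g 3 2 1"
proof -
  let ?t = "Transposition.transpose"
  have "(\<Sum>p\<in>S3. g (p 1) (p 2) (p 3)) =
      (\<Sum>i\<in>{1, 2, 3}. \<Sum>j\<in>{2, 3}. g (?t 1 i 1) (?t 1 i (?t 2 j 2)) (?t 1 i (?t 2 j 3)))"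
    by (simp add: sum_over_permutations_insert permutes_sing Transposition.transpose_def)
  also have "\<dots> = g 1 2 3 + g 1 3 2 + g 2 1 3 + g 2 3 1 + g 3 1 2 + g 3 2 1"
    by (simp add: Transposition.transpose_def add_ac)
  finally show ?thesis .
qed

context albert_algebra
begin

text \<open>Adding the diagonal values at \<open>x + y\<close> and \<open>x - y\<close> cancels the
  odd terms and leaves 12 times \<open>F x x y y\<close>. Two further polarisations separate the
  remaining arguments.\<close>

lemma symmetric_quadrilinear_eq_0:
  fixes F :: "'v::ab_group_add \<Rightarrow> 'v \<Rightarrow> 'v \<Rightarrow> 'v \<Rightarrow> 'k"
  assumes add: "\<And>x x' y z w. F (x + x') y z w = F x y z w + F x' y z w"
    and sym: "\<And>x y z w. F x y z w = F y x z w" "\<And>x y z w. F x y z w = F x z y w"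
      "\<And>x y z w. F x y z w = F x y w z"
    and zero: "\<And>x. F x x x x = 0"
  shows "F x y z w = 0"
proof -
  have add2: "F y (x + x') z w = F y x z w + F y x' z w" for x x' y z w
    by (metis add sym(1))
  have add3: "F y z (x + x') w = F y z x w + F y z x' w" for x x' y z w
    by (metis add2 sym(2))
  have add4: "F y z w (x + x') = F y z w x + F y z w x'" for x x' y z w
    by (metis add3 sym(3))
  note adds = add add2 add3 add4
  have F0: "F 0 y z w = 0" for y z w
    using add[of 0 0 y z w] by (metis add_0 add_cancel_left_left)
  have neg1: "F (- x) y z w = - F x y z w" for x y z w
    using add[of x "- x" y z w] F0[of y z w] by (simp add: eq_neg_iff_add_eq_0 add.commute)
  have neg2: "F y (- x) z w = - F y x z w" for x y z w
    by (metis neg1 sym(1))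
  have neg3: "F y z (- x) w = - F y z x w" for x y z w
    by (metis neg2 sym(2))
  have neg4: "F y z w (- x) = - F y z w x" for x y z w
    by (metis neg3 sym(3))
  have "(2 * 2 * 3) * F x x y y = 0" for x y
  proof -
    have s: "F y x x x = F x x x y" "F x y x x = F x x x y" "F x x y x = F x x x y"
      "F y y x x = F x x y y" "F y x y x = F x x y y" "F y x x y = F x x y y"
      "F x y x y = F x x y y" "F x y y x = F x x y y"
      "F y y y x = F x y y y" "F y y x y = F x y y y" "F y x y y = F x y y y"
      by (metis sym)+
    have "F (x + y) (x + y) (x + y) (x + y) + F (x + - y) (x + - y) (x + - y) (x + - y)
        = 2 * F x x x x + 2 * 2 * 3 * F x x y y + 2 * F y y y y"
      unfolding adds neg1 neg2 neg3 neg4 s by simp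
    then show ?thesis by (simp add: zero)
  qed
  then have xxyy: "F x x y y = 0" for x y
    using two_neq_0 three_neq_0 by (metis mult_eq_0_iff)
  have xzyy: "F x z y y = 0" for x y z
  proof -
    have "F (x + z) (x + z) y y = F x x y y + F z z y y + 2 * F x z y y"
      unfolding adds by (simp add: sym(1)[of z x])
    then show ?thesis using two_neq_0 by (simp add: xxyy)
  qed
  have "F x y (z + w) (z + w) = F x y z z + F x y w w + 2 * F x y z w"
    unfolding adds by (simp add: sym(3)[of x y w z])
  then show ?thesis using two_neq_0 by (simp add: xzyy)
qed

text \<open>Paired with a fixed \<open>v\<close>, four times the difference of the two sides is
  symmetric in all four arguments: on the left there is one term for each splitting into two pairs,
  on the right one for each argument left out of \<open>tr3\<close>. On the diagonal it vanishes by
  \<open>adjoint_identity\<close>.\<close>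

lemma adjoint_identity_polarized:
  "(x \<times>\<times> w) \<times>\<times> (y \<times>\<times> z) + (y \<times>\<times> w) \<times>\<times> (x \<times>\<times> z) + (z \<times>\<times> w) \<times>\<times> (x \<times>\<times> y)
    = (3 / 4) *\<^sub>W (triple_op \<O> x y z w + tr3 x y z *\<^sub>W w)"
proof (rule trace_form_eqI)
  fix v
  define F where "F x y z w =
      4 * (T ((x \<times>\<times> w) \<times>\<times> (y \<times>\<times> z)) v + T ((y \<times>\<times> w) \<times>\<times> (x \<times>\<times> z)) v
        + T ((z \<times>\<times> w) \<times>\<times> (x \<times>\<times> y)) v)
      - 3 * (tr3 x y z * T w v + tr3 x y w * T z v + tr3 x z w * T y v + tr3 y z w * T x v)"
    for x y z w
  have "F x y z w = 0"
  proof (rule symmetric_quadrilinear_eq_0[of F])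
    show "F (x + x') y z w = F x y z w + F x' y z w" for x x' y z w
      by (simp add: F_def cross_simps trace_form_simps tri_simps algebra_simps)
    show "F x y z w = F y x z w" "F x y z w = F x z y w" "F x y z w = F x y w z" for x y z w
      by (simp_all add: F_def cross_commute tri_commute algebra_simps)
    show "F x x x x = 0" for x
      by (simp add: F_def adjoint_identity trace_form_simps tri_diag)
  qed
  moreover have "tr3 w x y = tr3 x y w" "tr3 w y z = tr3 y z w" "tr3 w z x = tr3 x z w"
    by (metis tri_commute)+
  ultimately have "4 * T ((x \<times>\<times> w) \<times>\<times> (y \<times>\<times> z) + (y \<times>\<times> w) \<times>\<times> (x \<times>\<times> z) + (z \<times>\<times> w) \<times>\<times> (x \<times>\<times> y)) v
      = 3 * T (triple_op \<O> x y z w + tr3 x y z *\<^sub>W w) v"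
    by (simp add: F_def triple_op_def trace_form_simps algebra_simps)
  then show "T ((x \<times>\<times> w) \<times>\<times> (y \<times>\<times> z) + (y \<times>\<times> w) \<times>\<times> (x \<times>\<times> z) + (z \<times>\<times> w) \<times>\<times> (x \<times>\<times> y)) v
      = T ((3 / 4) *\<^sub>W (triple_op \<O> x y z w + tr3 x y z *\<^sub>W w)) v"
    unfolding trace_form_simps(2) using two_powers_neq_0(1)
    by (simp add: nonzero_eq_divide_eq mult.commute)
qed

section \<open>The space of operators spanned by the triple products\<close>

sublocale ops: vector_space "escale \<O>"
  by unfold_locales
    (simp_all add: escale_def fun_eq_iff alb.scale_right_distrib alb.scale_left_distrib)

lemma triple_op_simps:
  "triple_op \<O> (x + x') y z = triple_op \<O> x y z + triple_op \<O> x' y z"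
  "triple_op \<O> (r *\<^sub>W x) y z = escale \<O> r (triple_op \<O> x y z)"
  "triple_op \<O> y (x + x') z = triple_op \<O> y x z + triple_op \<O> y x' z"
  "triple_op \<O> y (r *\<^sub>W x) z = escale \<O> r (triple_op \<O> y x z)"
  "triple_op \<O> y z (x + x') = triple_op \<O> y z x + triple_op \<O> y z x'"
  "triple_op \<O> y z (r *\<^sub>W x) = escale \<O> r (triple_op \<O> y z x)"
  by (simp_all add: triple_op_def escale_def fun_eq_iff tri_simps alb.scale_left_distrib
      alb.scale_right_distrib algebra_simps)

lemma triple_op_in_sigma_A: "triple_op \<O> x y z \<in> sigma_A \<O>"
proof -
  have "triple_op \<O> x y z = op_of \<O> (\<lambda>i. if i = 1 then x else if i = 2 then y else z)"
    by (simp add: op_of_def)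
  then show ?thesis
    by (simp only: sigma_A_def) (rule ops.span_base[OF rangeI])
qed

lemma subspace_sigma_A: "ops.subspace (sigma_A \<O>)"
  by (simp add: sigma_A_def)

lemma sigma_A_induct [consumes 1, case_names subspace op_of]:
  assumes "A \<in> sigma_A \<O>" "ops.subspace {A. Q A}" "\<And>a. Q (op_of \<O> a)"
  shows "Q A"
  using ops.span_induct[of A "range (op_of \<O>)" Q] assms by (auto simp: sigma_A_def)

lemma linear_op_of: "Vector_Spaces.linear (hscale \<O>) (hscale \<O>) (op_of \<O> a)"
  by unfold_locales
    (simp_all add: op_of_def triple_op_def tri_simps alb.scale_left_distrib
      alb.scale_right_distrib algebra_simps)

lemma linear_sigma_A:
  assumes "A \<in> sigma_A \<O>"
  shows "Vector_Spaces.linear (hscale \<O>) (hscale \<O>) A"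
  using assms
proof (induct rule: sigma_A_induct)
  case subspace
  show ?case
    by (auto simp: ops.subspace_def Vector_Spaces.linear_iff alb.vector_space_axioms escale_def
        alb.scale_right_distrib algebra_simps)
qed (rule linear_op_of)

end

text \<open>The assumptions are what \<open>dual_bases\<close> provides; fixing the bases in a
  locale allows definitions to refer to them.\<close>

locale albert_dual_bases = albert_algebra \<O>
  for \<O> :: "('k::field, 'o::ab_group_add) octonion_data" +
  fixes K :: "'i set" and e f :: "'i \<Rightarrow> ('k, 'o) herm3"
  assumes finite_K: "finite K"
    and expand: "\<And>w. w = (\<Sum>k\<in>K. T w (f k) *\<^sub>W e k)"
    and sum_dual: "(\<Sum>k\<in>K. T (e k) (f k)) = 27"
    and casimir: "\<And>p q. (\<Sum>k\<in>K. T (p \<times>\<times> e k) (q \<times>\<times> f k)) = 5 / 2 * T p q"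
begin

section \<open>Traces and contractions in dual bases\<close>

lemma parseval: "(\<Sum>k\<in>K. T x (e k) * T (f k) y) = T x y"
  by (subst (2) expand[of y]) (simp add: trace_form_simps trace_form_commute mult.commute)

lemma expand_dual: "w = (\<Sum>k\<in>K. T w (e k) *\<^sub>W f k)"
  by (rule trace_form_eqI) (simp add: trace_form_simps parseval)

definition optr :: "(('k, 'o) herm3 \<Rightarrow> ('k, 'o) herm3) \<Rightarrow> 'k" where
  "optr A = (\<Sum>k\<in>K. T (A (e k)) (f k))"

lemma endo_trace_eq:
  assumes A: "Vector_Spaces.linear (hscale \<O>) (hscale \<O>) A"
  shows "endo_trace (hscale \<O>) A = optr A"
proof -
  define X where "X = (SOME X. alb.independent X \<and> alb.span X = UNIV)"
  have "\<exists>X. alb.independent X \<and> alb.span X = UNIV"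
    using alb.basis_exists[of UNIV] by (metis top.extremum_unique)
  then have "alb.independent X \<and> alb.span X = UNIV"
    unfolding X_def by (rule someI_ex)
  then have X: "alb.independent X" "alb.span X = UNIV" by simp_all
  have "w \<in> alb.span (e ` K)" for w
    by (subst expand) (intro alb.span_sum alb.span_scale alb.span_base imageI)
  then have fin: "finite X"
    using alb.independent_span_bound[of "e ` K" X] X finite_K by auto
  let ?R = "alb.representation X"
  note R = alb.representation_sum[OF X(1)] alb.representation_scale[OF X(1)]
  note hom = A[THEN module_hom_linearI]
  have exp: "(\<Sum>b\<in>X. ?R w b *\<^sub>W b) = w" for w
    using alb.sum_representation_eq[OF X(1), of w X] X fin by simp
  have "(\<Sum>b\<in>X. ?R (A b) b) = (\<Sum>b\<in>X. \<Sum>k\<in>K. T b (f k) * ?R (A (e k)) b)"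
  proof (rule sum.cong)
    fix b
    have "A b = (\<Sum>k\<in>K. T b (f k) *\<^sub>W A (e k))"
      by (subst expand[of b]) (simp add: module_hom.sum[OF hom] module_hom.scale[OF hom])
    then show "?R (A b) b = (\<Sum>k\<in>K. T b (f k) * ?R (A (e k)) b)"
      using X by (simp add: R)
  qed simp
  also have "\<dots> = (\<Sum>k\<in>K. \<Sum>b\<in>X. T b (f k) * ?R (A (e k)) b)"
    by (rule sum.swap)
  also have "\<dots> = optr A"
    unfolding optr_def
    by (intro sum.cong refl, subst exp[of "A _", symmetric])
      (simp add: trace_form_simps mult.commute)
  finally show ?thesis
    by (simp add: endo_trace_def X_def Let_def)
qed

lemma cross_expand: "x \<times>\<times> y = (\<Sum>k\<in>K. (3 * tr3 (e k) x y) *\<^sub>W f k)"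
  by (subst expand_dual)
    (intro sum.cong refl, metis trace_cross_right trace_form_commute tri_commute)

text \<open>Expanding the cross product by \<open>cross_expand\<close> produces the coefficients
  \<open>tr3 (e k)\<close> that also occur in \<open>triple_op\<close>, so the sum sees the triple
  only through its operator. The 6 is the 3 of \<open>cross_expand\<close> times 2 for the order
  inside the cross product.\<close>

lemma sum_S3_eq_contraction:
  assumes V: "vector_space sV"
    and hom: "\<And>v. module_hom (hscale \<O>) sV (\<lambda>u. \<beta> u v)" "\<And>u. module_hom (hscale \<O>) sV (\<beta> u)"
  shows "(\<Sum>p\<in>S3. \<beta> (a (p 1)) (a (p 2) \<times>\<times> a (p 3))) = sV 6 (\<Sum>k\<in>K. \<beta> (op_of \<O> a (e k)) (f k))"
proof -
  interpret V: vector_space sV by (rule V)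
  have R: "\<beta> u (x \<times>\<times> y) = sV 3 (\<Sum>k\<in>K. sV (tr3 (e k) x y) (\<beta> u (f k)))" for u x y
    by (subst cross_expand)
      (simp add: module_hom.sum[OF hom(2)] module_hom.scale[OF hom(2)] V.scale_sum_right)
  have "(\<Sum>k\<in>K. \<beta> (op_of \<O> a (e k)) (f k)) =
      (\<Sum>k\<in>K. sV (tr3 (e k) (a 1) (a 2)) (\<beta> (a 3) (f k)))
      + (\<Sum>k\<in>K. sV (tr3 (e k) (a 2) (a 3)) (\<beta> (a 1) (f k)))
      + (\<Sum>k\<in>K. sV (tr3 (e k) (a 3) (a 1)) (\<beta> (a 2) (f k)))"
    by (simp add: op_of_def triple_op_def module_hom.add[OF hom(1)] module_hom.scale[OF hom(1)]
        sum.distrib)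
  then have "sV 3 (\<Sum>k\<in>K. \<beta> (op_of \<O> a (e k)) (f k)) =
      \<beta> (a 3) (a 1 \<times>\<times> a 2) + \<beta> (a 1) (a 2 \<times>\<times> a 3) + \<beta> (a 2) (a 3 \<times>\<times> a 1)"
    by (simp only: R V.scale_right_distrib)
  then have "sV 2 (sV 3 (\<Sum>k\<in>K. \<beta> (op_of \<O> a (e k)) (f k))) =
      sV 2 (\<beta> (a 3) (a 1 \<times>\<times> a 2) + \<beta> (a 1) (a 2 \<times>\<times> a 3) + \<beta> (a 2) (a 3 \<times>\<times> a 1))"
    by simp
  moreover have "sV 2 x = x + x" for x
    using V.scale_left_distrib[of 1 1 x] by simp
  ultimately show ?thesis
    unfolding sum_S3[of "\<lambda>i j l. \<beta> (a i) (a j \<times>\<times> a l)"] V.scale_scale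
    by (simp add: cross_commute add_ac)
qed

lemma optr_triple_op: "optr (triple_op \<O> x y z) = 3 * tr3 x y z"
proof -
  have "(\<Sum>k\<in>K. tr3 (e k) x y * T z (f k)) = tr3 x y z" for x y z
  proof -
    have "3 * (\<Sum>k\<in>K. tr3 (e k) x y * T z (f k)) = 3 * tr3 x y z"
      using arg_cong[OF cross_expand[of x y], of "T z"]
      by (simp add: trace_form_simps sum_distrib_left trace_cross_right mult.assoc)
    then show ?thesis using three_neq_0 mult_left_cancel by blast
  qed
  moreover have "tr3 y z x = tr3 x y z" "tr3 z x y = tr3 x y z"
    by (metis tri_commute)+
  ultimately show ?thesis
    by (simp add: optr_def triple_op_def trace_form_simps sum.distrib)
qed

section \<open>The product\<close>

text \<open>Here 216 = 6 * 6 * 6 has one factor for each contracted triple (\<open>b\<close>,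
  \<open>a\<close> and \<open>x m\<close>), and 5 = 5/4 * 4 uses \<open>f_prime_eq\<close>. The pair
  \<open>e k\<close>, \<open>f k\<close> represents the identity operator.\<close>

definition odot :: "(('k, 'o) herm3 \<Rightarrow> ('k, 'o) herm3) \<Rightarrow> (('k, 'o) herm3 \<Rightarrow> ('k, 'o) herm3) \<Rightarrow>
    ('k, 'o) herm3 \<Rightarrow> ('k, 'o) herm3" where
  "odot A C = escale \<O> 216 (\<Sum>k\<in>K. \<Sum>i\<in>K. \<Sum>j\<in>K.
      triple_op \<O> ((A (e i) \<times>\<times> C (e j)) \<times>\<times> e k) (f i \<times>\<times> f j) (f k))
    - escale \<O> (5 * (\<Sum>i\<in>K. \<Sum>j\<in>K. T (A (e i)) (f j) * T (C (e j)) (f i))) id"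

lemma trace_cross_assoc: "T (x \<times>\<times> y) z = T x (y \<times>\<times> z)"
  by (metis trace_cross trace_cross_right tri_commute)

text \<open>Writing both values of \<open>tr3\<close> as thirds of trace pairings costs 9, and
  contracting both triples brings 6 * 6, so the constant is 36 / 9 = 4.\<close>

lemma f_prime_eq:
  "f_prime \<O> a b =
    4 * (\<Sum>i\<in>K. \<Sum>j\<in>K. T (op_of \<O> a (e i)) (f j) * T (op_of \<O> b (e j)) (f i))"
proof -
  let ?A = "op_of \<O> a" and ?C = "op_of \<O> b"
  have nine: "(9::'k) \<noteq> 0"
    using power_not_zero[OF three_neq_0, of 2] by simp
  have V: "vector_space ((*) :: 'k \<Rightarrow> 'k \<Rightarrow> 'k)"
    by unfold_locales (simp_all add: algebra_simps)
  have hom: "module_hom (hscale \<O>) (*) (\<lambda>x. g x)"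
    if "\<And>x y. g (x + y) = g x + g y" "\<And>r x. g (r *\<^sub>W x) = r * g x" for g :: "_ \<Rightarrow> 'k"
    using that by unfold_locales (simp_all add: algebra_simps)
  have "9 * f_prime \<O> a b
      = (\<Sum>p\<in>S3. \<Sum>q\<in>S3. T (a (p 1)) (b (q 2) \<times>\<times> b (q 3)) * T (a (p 2) \<times>\<times> a (p 3)) (b (q 1)))"
  proof -
    have "9 * (tr3 x y z * tr3 x' y' z') = T x (y \<times>\<times> z) * T (y' \<times>\<times> z') x'" for x y z x' y' z'
    proof -
      have "tr3 y z x = tr3 x y z" "tr3 y' z' x' = tr3 x' y' z'" by (metis tri_commute)+
      then show ?thesis by (simp add: trace_cross trace_cross_right)
    qed
    then show ?thesis by (simp add: f_prime_def sum_distrib_left)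
  qed
  \<comment> \<open>The inner sum over \<open>q\<close> is contracted first; the underscores in the
    instantiation are to be filled by the bound permutation \<open>p\<close>.\<close>
  also have "\<dots> = (\<Sum>p\<in>S3. 6 * (\<Sum>j\<in>K. T (a (p 1)) (f j) * T (a (p 2) \<times>\<times> a (p 3)) (?C (e j))))"
    by (intro sum.cong refl sum_S3_eq_contraction[OF V,
          of "\<lambda>u v. T (a (_ 1)) v * T (a (_ 2) \<times>\<times> a (_ 3)) u"] hom)
      (simp_all add: trace_form_simps algebra_simps)
  also have "\<dots> = 6 * (\<Sum>j\<in>K. \<Sum>p\<in>S3. T (a (p 1)) (f j) * T (a (p 2) \<times>\<times> a (p 3)) (?C (e j)))"
    unfolding sum_distrib_left by (rule sum.swap)
  also have "\<dots> = 6 * (\<Sum>j\<in>K. 6 * (\<Sum>i\<in>K. T (?A (e i)) (f j) * T (f i) (?C (e j))))"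
    by (intro arg_cong[of _ _ "(*) 6"] sum.cong refl sum_S3_eq_contraction[OF V,
          of "\<lambda>u v. T u (f _) * T v (?C (e _))"] hom)
      (simp_all add: trace_form_simps algebra_simps)
  also have "\<dots> = 9 * (4 * (\<Sum>i\<in>K. \<Sum>j\<in>K. T (?A (e i)) (f j) * T (?C (e j)) (f i)))"
  proof -
    have "(\<Sum>j\<in>K. \<Sum>i\<in>K. T (?A (e i)) (f j) * T (f i) (?C (e j)))
        = (\<Sum>i\<in>K. \<Sum>j\<in>K. T (?A (e i)) (f j) * T (?C (e j)) (f i))"
      unfolding trace_form_commute[of "f _"] by (rule sum.swap)
    then show ?thesis by (simp flip: sum_distrib_left)
  qed
  finally show ?thesis
    unfolding mult_left_cancel[OF nine] .
qed

lemma module_hom_triple: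
  assumes "\<And>x y. g (x + y) = g x + g y" "\<And>r x. g (r *\<^sub>W x) = escale \<O> r (g x)"
  shows "module_hom (hscale \<O>) (escale \<O>) g"
  using assms by unfold_locales auto

text \<open>The permutation sums over \<open>q\<close>, \<open>p\<close> and \<open>s\<close> are
  contracted in turn. After the last one the \<open>x m\<close> enter only through the sum of their
  operators, which is \<open>id\<close>; hence the value depends neither on the decomposition nor on
  the triples that represent the two factors.\<close>

lemma odot2_eq_odot:
  assumes "id_decomposition \<O> n x"
  shows "odot2 \<O> n x a b = odot (op_of \<O> a) (op_of \<O> b)"
proof -
  let ?A = "op_of \<O> a" and ?C = "op_of \<O> b"
  note contraction = sum_S3_eq_contraction[OF ops.vector_space_axioms]
  have q: "(\<Sum>q\<in>S3. triple_op \<O> ((a' \<times>\<times> b (q 1)) \<times>\<times> y) (a'' \<times>\<times> (b (q 2) \<times>\<times> b (q 3))) z)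
      = escale \<O> 6 (\<Sum>j\<in>K. triple_op \<O> ((a' \<times>\<times> ?C (e j)) \<times>\<times> y) (a'' \<times>\<times> f j) z)" for a' a'' y z
    by (intro contraction[of "\<lambda>u v. triple_op \<O> ((a' \<times>\<times> u) \<times>\<times> y) (a'' \<times>\<times> v) z"] module_hom_triple)
      (simp_all add: cross_simps triple_op_simps)
  have p: "(\<Sum>p\<in>S3. \<Sum>j\<in>K. triple_op \<O> ((a (p 1) \<times>\<times> ?C (e j)) \<times>\<times> y) ((a (p 2) \<times>\<times> a (p 3)) \<times>\<times> f j) z)
      = escale \<O> 6 (\<Sum>i\<in>K. \<Sum>j\<in>K. triple_op \<O> ((?A (e i) \<times>\<times> ?C (e j)) \<times>\<times> y) (f i \<times>\<times> f j) z)" for y z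
    by (intro contraction[of "\<lambda>u v. \<Sum>j\<in>K. triple_op \<O> ((u \<times>\<times> ?C (e j)) \<times>\<times> y) (v \<times>\<times> f j) z"] module_hom_triple)
      (simp_all add: cross_simps triple_op_simps sum.distrib ops.scale_sum_right)
  \<comment> \<open>What remains after \<open>b\<close> and \<open>a\<close> are contracted, as a
    bilinear map in the two slots filled from \<open>x m\<close>.\<close>
  define \<gamma> where "\<gamma> y z = (\<Sum>i\<in>K. \<Sum>j\<in>K. triple_op \<O> ((?A (e i) \<times>\<times> ?C (e j)) \<times>\<times> y) (f i \<times>\<times> f j) z)"
    for y z
  have hom: "module_hom (hscale \<O>) (escale \<O>) (\<lambda>u. \<gamma> u v)" "module_hom (hscale \<O>) (escale \<O>) (\<gamma> u)"
    for u v
    by (intro module_hom_triple;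
        simp add: \<gamma>_def cross_simps triple_op_simps sum.distrib ops.scale_sum_right)+
  have "(\<Sum>m<n. \<Sum>s\<in>S3. \<Sum>p\<in>S3. \<Sum>q\<in>S3. triple_op \<O> ((a (p 1) \<times>\<times> b (q 1)) \<times>\<times> x m (s 1))
        ((a (p 2) \<times>\<times> a (p 3)) \<times>\<times> (b (q 2) \<times>\<times> b (q 3))) (x m (s 2) \<times>\<times> x m (s 3)))
      = (\<Sum>m<n. \<Sum>s\<in>S3. escale \<O> 36 (\<gamma> (x m (s 1)) (x m (s 2) \<times>\<times> x m (s 3))))"
    unfolding q ops.scale_sum_right[symmetric] p \<gamma>_def by simp
  also have "\<dots> = escale \<O> 36 (\<Sum>m<n. \<Sum>s\<in>S3. \<gamma> (x m (s 1)) (x m (s 2) \<times>\<times> x m (s 3)))"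
    by (simp add: ops.scale_sum_right)
  also have "\<dots> = escale \<O> 216 (\<Sum>m<n. \<Sum>k\<in>K. \<gamma> (op_of \<O> (x m) (e k)) (f k))"
    unfolding contraction[of \<gamma>, OF hom] ops.scale_sum_right[symmetric] by simp
  also have "(\<Sum>m<n. \<Sum>k\<in>K. \<gamma> (op_of \<O> (x m) (e k)) (f k))
      = (\<Sum>k\<in>K. \<gamma> ((\<Sum>m<n. op_of \<O> (x m)) (e k)) (f k))"
  proof -
    have sum_apply: "(\<Sum>m<n. g m) w = (\<Sum>m<n. g m w)" for g :: "nat \<Rightarrow> ('k, 'o) herm3 \<Rightarrow> ('k, 'o) herm3" and n w
      by (induct n) simp_all
    show ?thesis
      by (subst sum.swap) (simp add: sum_apply module_hom.sum[OF hom(1)])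
  qed
  also have "\<dots> = (\<Sum>k\<in>K. \<gamma> (e k) (f k))"
    using assms by (simp add: id_decomposition_def)
  finally show ?thesis
    using two_powers_neq_0
    by (simp add: odot2_def odot_def \<gamma>_def f_prime_eq)
qed

lemma id_in_sigma_A:
  assumes "id_decomposition \<O> n x"
  shows "id \<in> sigma_A \<O>"
  using ops.subspace_sum[OF subspace_sigma_A, of "{..<n}" "\<lambda>m. op_of \<O> (x m)"] assms
  by (simp add: id_decomposition_def op_of_def triple_op_in_sigma_A)

lemma odot_in_sigma_A:
  assumes "id \<in> sigma_A \<O>"
  shows "odot A C \<in> sigma_A \<O>"
  unfolding odot_def
  by (intro ops.subspace_diff ops.subspace_scale ops.subspace_sum subspace_sigma_A
      triple_op_in_sigma_A assms)

section \<open>Commutativity and bilinearity\<close>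

lemma odot_commute: "odot A C = odot C A"
proof -
  have "(\<Sum>i\<in>K. \<Sum>j\<in>K. triple_op \<O> ((A (e i) \<times>\<times> C (e j)) \<times>\<times> e k) (f i \<times>\<times> f j) (f k))
      = (\<Sum>i\<in>K. \<Sum>j\<in>K. triple_op \<O> ((C (e i) \<times>\<times> A (e j)) \<times>\<times> e k) (f i \<times>\<times> f j) (f k))" for k
    by (subst sum.swap) (simp add: cross_commute)
  moreover have "(\<Sum>i\<in>K. \<Sum>j\<in>K. T (A (e i)) (f j) * T (C (e j)) (f i))
      = (\<Sum>i\<in>K. \<Sum>j\<in>K. T (C (e i)) (f j) * T (A (e j)) (f i))"
    by (subst sum.swap) (simp add: mult.commute)
  ultimately show ?thesis by (simp add: odot_def)
qed

lemma odot_add_left: "odot (A + A') C = odot A C + odot A' C"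
  by (simp add: odot_def cross_simps triple_op_simps trace_form_simps sum.distrib
      ops.scale_right_distrib ops.scale_left_distrib distrib_right distrib_left)

lemma odot_scale_left: "odot (escale \<O> r A) C = escale \<O> r (odot A C)"
proof -
  have A: "escale \<O> r A w = r *\<^sub>W A w" for w
    by (simp add: escale_def)
  show ?thesis
    by (simp add: odot_def A cross_simps triple_op_simps trace_form_simps ops.scale_right_diff_distrib
        mult.assoc flip: ops.scale_sum_right sum_distrib_left) (simp add: mult_ac)
qed

lemma odot_add_right: "odot C (A + A') = odot C A + odot C A'"
  using odot_add_left by (simp add: odot_commute[of C])

lemma odot_scale_right: "odot C (escale \<O> r A) = escale \<O> r (odot C A)"
  using odot_scale_left by (simp add: odot_commute[of C])

section \<open>The trace of the product\<close>

lemma optr_add: "optr (A + C) = optr A + optr C"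
  by (simp add: optr_def trace_form_simps sum.distrib)

lemma optr_scale: "optr (escale \<O> r A) = r * optr A"
  by (simp add: optr_def escale_def trace_form_simps sum_distrib_left)

lemma optr_diff: "optr (A - C) = optr A - optr C"
  by (simp add: optr_def trace_form_simps sum_subtractf)

lemma optr_sum: "optr (\<Sum>i\<in>I. g i) = (\<Sum>i\<in>I. optr (g i))"
proof (induct I rule: infinite_finite_induct)
  case (insert i I) show ?case
    unfolding sum.insert[OF insert(1,2)] optr_add by (rule arg_cong[OF insert(3)])
qed (simp_all add: optr_def trace_form_simps)

lemma optr_id: "optr id = 27"
  by (simp add: optr_def sum_dual)

text \<open>Both sides are linear in \<open>A\<close>. For a generator, six times the left side is a
  permutation sum equal to twice the left side of \<open>adjoint_identity_polarized\<close>. So the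
  constant is 2 * (3/4) / 6 = 1/4, and \<open>tr3\<close> is a third of the trace by
  \<open>optr_triple_op\<close>.\<close>

lemma contraction_sigma_A:
  assumes "A \<in> sigma_A \<O>"
  shows "(\<Sum>i\<in>K. (A (e i) \<times>\<times> w) \<times>\<times> f i) = (1 / 4) *\<^sub>W (A w + (optr A / 3) *\<^sub>W w)"
  using assms
proof (induct rule: sigma_A_induct)
  case subspace
  show ?case
  proof (rule ops.subspaceI; unfold mem_Collect_eq)
    show "(\<Sum>i\<in>K. (0 (e i) \<times>\<times> w) \<times>\<times> f i) = (1 / 4) *\<^sub>W (0 w + (optr 0 / 3) *\<^sub>W w)"
      by (simp add: optr_def cross_simps trace_form_simps)
  next
    fix A C :: "('k, 'o) herm3 \<Rightarrow> ('k, 'o) herm3"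
    assume "(\<Sum>i\<in>K. (A (e i) \<times>\<times> w) \<times>\<times> f i) = (1 / 4) *\<^sub>W (A w + (optr A / 3) *\<^sub>W w)"
      "(\<Sum>i\<in>K. (C (e i) \<times>\<times> w) \<times>\<times> f i) = (1 / 4) *\<^sub>W (C w + (optr C / 3) *\<^sub>W w)"
    then show "(\<Sum>i\<in>K. ((A + C) (e i) \<times>\<times> w) \<times>\<times> f i)
        = (1 / 4) *\<^sub>W ((A + C) w + (optr (A + C) / 3) *\<^sub>W w)"
      by (simp add: cross_simps sum.distrib optr_add add_divide_distrib alb.scale_right_distrib
          alb.scale_left_distrib)
  next
    fix r and A :: "('k, 'o) herm3 \<Rightarrow> ('k, 'o) herm3"
    assume A: "(\<Sum>i\<in>K. (A (e i) \<times>\<times> w) \<times>\<times> f i) = (1 / 4) *\<^sub>W (A w + (optr A / 3) *\<^sub>W w)"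
    have "(\<Sum>i\<in>K. (escale \<O> r A (e i) \<times>\<times> w) \<times>\<times> f i) = r *\<^sub>W (\<Sum>i\<in>K. (A (e i) \<times>\<times> w) \<times>\<times> f i)"
      by (simp add: escale_def cross_simps alb.scale_sum_right)
    also have "\<dots> = (1 / 4) *\<^sub>W (escale \<O> r A w + (optr (escale \<O> r A) / 3) *\<^sub>W w)"
      unfolding A optr_scale by (simp add: escale_def alb.scale_right_distrib)
    finally show "(\<Sum>i\<in>K. (escale \<O> r A (e i) \<times>\<times> w) \<times>\<times> f i)
        = (1 / 4) *\<^sub>W (escale \<O> r A w + (optr (escale \<O> r A) / 3) *\<^sub>W w)" .
  qed
next
  case (op_of a)
  let ?\<beta> = "\<lambda>u v. (u \<times>\<times> w) \<times>\<times> v"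
  have hom: "module_hom (hscale \<O>) (hscale \<O>) (\<lambda>u. ?\<beta> u v)" "module_hom (hscale \<O>) (hscale \<O>) (?\<beta> u)" for u v
    by unfold_locales (simp_all add: cross_simps)
  have "6 *\<^sub>W (\<Sum>i\<in>K. (op_of \<O> a (e i) \<times>\<times> w) \<times>\<times> f i)
      = (\<Sum>p\<in>S3. (a (p 1) \<times>\<times> w) \<times>\<times> (a (p 2) \<times>\<times> a (p 3)))"
    by (rule sum_S3_eq_contraction[OF alb.vector_space_axioms, of ?\<beta>, OF hom, symmetric])
  also have "\<dots> = 2 *\<^sub>W ((a 1 \<times>\<times> w) \<times>\<times> (a 2 \<times>\<times> a 3) + (a 2 \<times>\<times> w) \<times>\<times> (a 1 \<times>\<times> a 3)
      + (a 3 \<times>\<times> w) \<times>\<times> (a 1 \<times>\<times> a 2))"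
  proof -
    have "2 *\<^sub>W u = u + u" for u
      using alb.scale_left_distrib[of 1 1 u] by simp
    then show ?thesis
      by (simp only: sum_S3[of "\<lambda>i j l. (a i \<times>\<times> w) \<times>\<times> (a j \<times>\<times> a l)"])
        (simp add: cross_commute[of "a _" "a _"] algebra_simps)
  qed
  also have "\<dots> = 6 *\<^sub>W ((1 / 4) *\<^sub>W (op_of \<O> a w + (optr (op_of \<O> a) / 3) *\<^sub>W w))"
    unfolding adjoint_identity_polarized op_of_def optr_triple_op
    using two_neq_0 three_neq_0 two_powers_neq_0 by simp
  finally show ?case
    using six_neq_0 by (simp only: alb.scale_cancel_left) simp
qed

lemma optr_odot:
  assumes "A \<in> sigma_A \<O>"
  shows "optr (odot A C) = 45 * optr A * optr C"
proof -
  note hom = linear_sigma_A[OF assms, THEN module_hom_linearI]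
  let ?t = "\<Sum>j\<in>K. T (A (C (e j))) (f j)"
  \<comment> \<open>Expanding \<open>C (e j)\<close> in the basis combines the two factors into the
    trace of the composite of \<open>C\<close> followed by \<open>A\<close>.\<close>
  have t: "(\<Sum>i\<in>K. \<Sum>j\<in>K. T (A (e i)) (f j) * T (C (e j)) (f i)) = ?t"
  proof -
    have A: "A w = (\<Sum>i\<in>K. T w (f i) *\<^sub>W A (e i))" for w
      by (subst expand[of w]) (simp add: module_hom.sum[OF hom] module_hom.scale[OF hom])
    have "?t = (\<Sum>j\<in>K. T (\<Sum>i\<in>K. T (C (e j)) (f i) *\<^sub>W A (e i)) (f j))"
      by (simp only: A[of "C (e _)"])
    then show ?thesis
      by (subst sum.swap) (simp add: trace_form_simps mult.commute)
  qed
  have "(\<Sum>i\<in>K. \<Sum>j\<in>K. T (A (e i) \<times>\<times> C (e j)) (f i \<times>\<times> f j))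
      = (\<Sum>j\<in>K. T (\<Sum>i\<in>K. (A (e i) \<times>\<times> C (e j)) \<times>\<times> f i) (f j))"
    by (subst sum.swap) (simp add: trace_form_simps trace_cross_assoc)
  also have "\<dots> = 1 / 4 * (?t + optr A / 3 * optr C)"
    unfolding contraction_sigma_A[OF assms]
    by (simp only: trace_form_simps optr_def[of C] sum.distrib sum_distrib_left[symmetric])
  finally have gram: "(\<Sum>i\<in>K. \<Sum>j\<in>K. T (A (e i) \<times>\<times> C (e j)) (f i \<times>\<times> f j))
      = 1 / 4 * (?t + optr A / 3 * optr C)" .
  \<comment> \<open>The trace of a triple operator is a pairing of one entry with the cross product
    of the others. This is the shape that \<open>casimir\<close> evaluates with
    \<open>p = A (e i) \<times>\<times> C (e j)\<close> and
    \<open>q = f i \<times>\<times> f j\<close>.\<close>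
  have "optr (\<Sum>k\<in>K. \<Sum>i\<in>K. \<Sum>j\<in>K. triple_op \<O> ((A (e i) \<times>\<times> C (e j)) \<times>\<times> e k) (f i \<times>\<times> f j) (f k))
      = (\<Sum>i\<in>K. \<Sum>j\<in>K. \<Sum>k\<in>K. T ((A (e i) \<times>\<times> C (e j)) \<times>\<times> e k) ((f i \<times>\<times> f j) \<times>\<times> f k))"
  proof -
    have "3 * tr3 x y z = T x (y \<times>\<times> z)" for x y z
      by (simp flip: trace_cross_assoc add: trace_cross)
    then show ?thesis
      by (simp add: optr_sum optr_triple_op) (subst sum.swap, subst (2) sum.swap, rule refl)
  qed
  also have "\<dots> = 5 / 2 * (1 / 4 * (?t + optr A / 3 * optr C))"
    by (simp only: casimir gram flip: sum_distrib_left)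
  finally have S: "optr (\<Sum>k\<in>K. \<Sum>i\<in>K. \<Sum>j\<in>K.
      triple_op \<O> ((A (e i) \<times>\<times> C (e j)) \<times>\<times> e k) (f i \<times>\<times> f j) (f k))
      = 5 / 2 * (1 / 4 * (?t + optr A / 3 * optr C))" .
  have arith: "216 * (5 / 2 * (1 / 4 * (t + a / 3 * c))) - 5 * t * 27 = 45 * a * c" for t a c :: 'k
  proof -
    \<comment> \<open>The reciprocals 1/2, 1/4 and 1/3 enter as variables with their defining
      equations, so that \<open>algebra\<close> meets no division.\<close>
    have "216 * (5 * h * (q * (t + a * r * c))) - 5 * t * 27 = 45 * a * c"
      if "2 * h = 1" "4 * q = 1" "3 * r = 1" for h q r :: 'k
      using that by algebra
    from this[of "1 / 2" "1 / 4" "1 / 3"] show ?thesis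
      using two_neq_0 two_powers_neq_0 three_neq_0 by simp
  qed
  show ?thesis
    unfolding odot_def optr_diff optr_scale optr_id t S by (rule arith)
qed

end

section \<open>Equivariance\<close>

text \<open>Over a finite field the product of all \<open>[:- a, 1:]\<close>, plus 1, would be a
  polynomial of positive degree taking the value 1 everywhere.\<close>

lemma infinite_alg_closed_field: "infinite (UNIV :: 'a::alg_closed_field set)"
proof
  assume fin: "finite (UNIV :: 'a set)"
  define p :: "'a poly" where "p = (\<Prod>a\<in>UNIV. [:- a, 1:]) + 1"
  have "degree (\<Prod>a\<in>(UNIV :: 'a set). [:- a, 1:]) = card (UNIV :: 'a set)"
    by (subst degree_prod_sum_eq) simp_all
  moreover have "card (UNIV :: 'a set) > 0"
    using fin by (simp add: card_gt_0_iff)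
  ultimately have "degree p > 0"
    unfolding p_def by (subst degree_add_eq_left) simp_all
  then obtain x where "poly p x = 0"
    using alg_closed_imp_poly_has_root by blast
  moreover have "poly p x = 1"
    using fin by (simp add: p_def poly_prod)
  ultimately show False by simp
qed

lemma conj_act_sum:
  assumes "Vector_Spaces.linear s s g"
  shows "conj_act g (\<Sum>i\<in>I. h i) = (\<Sum>i\<in>I. conj_act g (h i))"
proof -
  note hom = module_hom_linearI[OF assms]
  show ?thesis
    by (induct I rule: infinite_finite_induct)
      (simp_all add: conj_act_def fun_eq_iff module_hom.add[OF hom] module_hom.zero[OF hom])
qed

context albert_algebra
begin

section \<open>The stabiliser of the determinant acting on forms and operators\<close>

lemma det_stabiliserD:
  assumes "g \<in> det_stabiliser \<O>"
  shows "Vector_Spaces.linear (hscale \<O>) (hscale \<O>) g" "bij g" "Dt (g x) = Dt x"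
    "g (inv g w) = w" "inv g (g w) = w"
  using assms by (auto simp: det_stabiliser_def bij_is_surj surj_f_inv_f bij_is_inj)

lemma det_stabiliser_simps:
  assumes "g \<in> det_stabiliser \<O>"
  shows "g (x + y) = g x + g y" "g (r *\<^sub>W x) = r *\<^sub>W g x" "g (x - y) = g x - g y"
    "inv g (r *\<^sub>W x) = r *\<^sub>W inv g x" "inv g (x + y) = inv g x + inv g y"
    "g (sum h I) = (\<Sum>i\<in>I. g (h i))" "inv g (sum h I) = (\<Sum>i\<in>I. inv g (h i))"
proof -
  note g = det_stabiliserD[OF assms]
  note hom = g(1)[THEN module_hom_linearI]
  show eqs: "g (x + y) = g x + g y" "g (r *\<^sub>W x) = r *\<^sub>W g x" "g (x - y) = g x - g y"
    "g (sum h I) = (\<Sum>i\<in>I. g (h i))" for x y r h I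
    by (rule module_hom.add[OF hom] module_hom.scale[OF hom] module_hom.diff[OF hom]
        module_hom.sum[OF hom])+
  show "inv g (r *\<^sub>W x) = r *\<^sub>W inv g x" "inv g (x + y) = inv g x + inv g y"
    "inv g (sum h I) = (\<Sum>i\<in>I. inv g (h i))"
    by (rule inv_f_eq[OF bij_is_inj[OF g(2)]]; simp add: eqs g)+
qed

text \<open>Polarisation expresses \<open>tr3\<close> through values of \<open>Dt\<close> at sums,
  which the linear map \<open>g\<close> preserves.\<close>

lemma tri_stabiliser:
  assumes "g \<in> det_stabiliser \<O>"
  shows "tr3 (g x) (g y) (g z) = tr3 x y z"
proof -
  have "6 * tr3 (g x) (g y) (g z) = 6 * tr3 x y z"
    unfolding symmetric_trilinear_polarization[of tr3 Dt, OF tri_simps(1) tri_commute tri_diag[symmetric]]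
    by (simp only: det_stabiliserD(3)[OF assms] flip: det_stabiliser_simps(1)[OF assms])
  then show ?thesis using six_neq_0 by simp
qed

lemma conj_act_triple_op:
  assumes "g \<in> det_stabiliser \<O>"
  shows "conj_act g (triple_op \<O> x y z) = triple_op \<O> (g x) (g y) (g z)"
proof -
  have "tr3 (inv g w) x y = tr3 w (g x) (g y)" for w x y
    using tri_stabiliser[OF assms, of "inv g w" x y] by (simp add: det_stabiliserD(4)[OF assms])
  then show ?thesis
    by (simp add: conj_act_def triple_op_def fun_eq_iff det_stabiliser_simps(1,2)[OF assms])
qed

lemma conj_act_op_of:
  assumes "g \<in> det_stabiliser \<O>"
  shows "conj_act g (op_of \<O> a) = op_of \<O> (\<lambda>i. g (a i))"
  by (simp add: op_of_def conj_act_triple_op[OF assms])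

lemma conj_act_simps:
  assumes "g \<in> det_stabiliser \<O>"
  shows "conj_act g (A + C) = conj_act g A + conj_act g C" "conj_act g 0 = 0"
    "conj_act g (A - C) = conj_act g A - conj_act g C"
    "conj_act g (escale \<O> r A) = escale \<O> r (conj_act g A)" "conj_act g id = id"
  using det_stabiliser_simps[OF assms] det_stabiliser_simps(2)[OF assms, of 0]
  by (simp_all add: conj_act_def escale_def fun_eq_iff det_stabiliserD[OF assms])

text \<open>A monic cubic has finitely many roots. Two values are wanted because the density
  argument has to annihilate an affine function of \<open>t\<close>.\<close>

lemma two_values_off_cubic:
  obtains t t' where "t \<noteq> t'" "c0 + c1 * t + c2 * t\<^sup>2 + t ^ 3 \<noteq> (0::'k)"
    "c0 + c1 * t' + c2 * t'\<^sup>2 + t' ^ 3 \<noteq> 0"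
proof -
  let ?Z = "{t. poly [:c0, c1, c2, 1:] t = 0}"
  have "finite ?Z" by (rule poly_roots_finite) simp
  then have "infinite (- ?Z)"
    using infinite_field by (simp add: Compl_eq_Diff_UNIV)
  moreover obtain t where t: "t \<in> - ?Z"
    using \<open>infinite (- ?Z)\<close> by (metis finite.emptyI ex_in_conv)
  ultimately have "infinite (- ?Z - {t})" by simp
  then obtain t' where "t' \<in> - ?Z - {t}"
    by (metis finite.emptyI ex_in_conv)
  with t show ?thesis
    by (intro that[of t t']) (auto simp: algebra_simps power2_eq_square power3_eq_cube)
qed

text \<open>This is Zariski density of the locus where the determinant does not vanish: on the line from \<open>x\<close> in
  the direction of the identity matrix the determinant is a monic cubic.\<close>

lemma symmetric_bilinear_eq_0:
  fixes \<delta> :: "('k, 'o) herm3 \<Rightarrow> ('k, 'o) herm3 \<Rightarrow> 'k"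
  assumes add: "\<And>x x' y. \<delta> (x + x') y = \<delta> x y + \<delta> x' y" "\<And>r x y. \<delta> (r *\<^sub>W x) y = r * \<delta> x y"
    and sym: "\<And>x y. \<delta> x y = \<delta> y x"
    and zero: "\<And>x. Dt x \<noteq> 0 \<Longrightarrow> \<delta> x x = 0"
  shows "\<delta> x y = 0"
proof -
  have adds: "\<delta> y (x + x') = \<delta> y x + \<delta> y x'" "\<delta> y (r *\<^sub>W x) = r * \<delta> y x" for x x' y r
    using add sym by metis+
  define E :: "('k, 'o) herm3" where "E = Herm3 1 1 1 0 0 0"
  have N0: "N 0 = 0"
    using onorm_scale[of 0 0] by simp
  have E: "Dt E = 1"
    by (simp add: hdet_def E_def N0 octonion_simps)
  have diag: "\<delta> x x = 0" for x
  proof -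
    have Dt: "Dt (x + t *\<^sub>W E) = Dt x + 3 * tr3 x x E * t + 3 * tr3 x E E * t\<^sup>2 + t ^ 3" for t
    proof -
      have "tr3 x E x = tr3 x x E" "tr3 E x x = tr3 x x E" "tr3 E x E = tr3 x E E" "tr3 E E x = tr3 x E E"
        by (metis tri_commute)+
      moreover have "tr3 E E E = 1" using E by (simp add: tri_diag)
      ultimately show ?thesis
        unfolding tri_diag[symmetric]
        by (simp add: tri_simps algebra_simps power2_eq_square power3_eq_cube)
    qed
    have EE: "\<delta> E E = 0" using zero[of E] E by simp
    \<comment> \<open>As \<open>\<delta> E E = 0\<close>, no quadratic term in \<open>t\<close>
      survives, and two admissible values of \<open>t\<close> force both coefficients to
      vanish.\<close>
    have line: "\<delta> x x + 2 * t * \<delta> x E = 0" if "Dt (x + t *\<^sub>W E) \<noteq> 0" for t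
      using zero[OF that] by (simp add: add adds EE sym[of E x] algebra_simps)
    obtain t t' where "t \<noteq> t'" "Dt (x + t *\<^sub>W E) \<noteq> 0" "Dt (x + t' *\<^sub>W E) \<noteq> 0"
      unfolding Dt using two_values_off_cubic by metis
    then have tt: "t \<noteq> t'" "\<delta> x x + 2 * t * \<delta> x E = 0" "\<delta> x x + 2 * t' * \<delta> x E = 0"
      using line by blast+
    have "2 * ((t - t') * \<delta> x E) = (\<delta> x x + 2 * t * \<delta> x E) - (\<delta> x x + 2 * t' * \<delta> x E)"
      by (simp add: algebra_simps)
    then have "2 * ((t - t') * \<delta> x E) = 0"
      by (simp only: tt diff_self)
    then have "\<delta> x E = 0" using tt(1) two_neq_0 by (metis mult_eq_0_iff right_minus_eq)
    then show ?thesis using tt(2) by simp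
  qed
  have "2 * \<delta> x y = \<delta> (x + y) (x + y) - \<delta> x x - \<delta> y y"
    by (simp add: add adds sym[of y x])
  then show ?thesis using two_neq_0 by (simp add: diag)
qed

end

section \<open>The contragredient of a stabiliser element and equivariance of the product\<close>

context albert_dual_bases
begin

text \<open>The inverse of the adjoint of \<open>g\<close> for the trace form, written in dual
  bases; \<open>trace_contragredient\<close> is its characterising property.\<close>

definition contragredient :: "(('k, 'o) herm3 \<Rightarrow> ('k, 'o) herm3) \<Rightarrow> ('k, 'o) herm3 \<Rightarrow> ('k, 'o) herm3" where
  "contragredient g x = (\<Sum>k\<in>K. T x (inv g (e k)) *\<^sub>W f k)"

context
  fixes g assumes g: "g \<in> det_stabiliser \<O>"
begin

abbreviation (input) "g' \<equiv> contragredient g"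

lemma trace_contragredient: "T (g' x) (g y) = T x y"
proof -
  have "inv g (g y) = (\<Sum>k\<in>K. T (g y) (f k) *\<^sub>W inv g (e k))"
    by (subst expand[of "g y"]) (simp add: det_stabiliser_simps[OF g])
  then have "y = (\<Sum>k\<in>K. T (g y) (f k) *\<^sub>W inv g (e k))"
    by (simp add: det_stabiliserD(5)[OF g])
  then have "T x y = T x (\<Sum>k\<in>K. T (g y) (f k) *\<^sub>W inv g (e k))"
    by simp
  then show ?thesis
    by (simp add: contragredient_def trace_form_simps trace_form_commute[of "f _" "g y"] mult.commute)
qed

lemma eq_by_trace_g: "(\<And>y. T u (g y) = T v (g y)) \<Longrightarrow> u = v"
  by (rule trace_form_eqI) (metis det_stabiliserD(4)[OF g])

lemma contragredient_simps: "g' (x + y) = g' x + g' y" "g' (r *\<^sub>W x) = r *\<^sub>W g' x"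
  by (rule eq_by_trace_g; simp add: trace_form_simps trace_contragredient)+

lemma cross_stabiliser: "g x \<times>\<times> g y = g' (x \<times>\<times> y)"
  by (rule eq_by_trace_g) (simp add: trace_contragredient trace_cross tri_stabiliser[OF g])

text \<open>On adjoints \<open>y \<times>\<times> y\<close> the diagonal case follows from
  \<open>cross_stabiliser\<close> and \<open>adjoint_identity\<close>. If
  \<open>Dt x \<noteq> 0\<close>, then \<open>x\<close> is a multiple of such an adjoint, and
  density extends the equality to all pairs.\<close>

lemma cross_contragredient: "g' x \<times>\<times> g' y = g (x \<times>\<times> y)"
proof (rule trace_form_eqI)
  fix z
  define \<delta> where "\<delta> x y = T (g' x \<times>\<times> g' y - g (x \<times>\<times> y)) z" for x y
  have "\<delta> x y = 0"
  proof (rule symmetric_bilinear_eq_0[of \<delta>])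
    show "\<delta> (x + x') y = \<delta> x y + \<delta> x' y" "\<delta> (r *\<^sub>W x) y = r * \<delta> x y" for x x' y r
      by (simp_all add: \<delta>_def contragredient_simps det_stabiliser_simps[OF g] cross_simps
          trace_form_simps algebra_simps)
    show "\<delta> x y = \<delta> y x" for x y
      by (simp add: \<delta>_def cross_commute)
    show "\<delta> x x = 0" if "Dt x \<noteq> 0" for x
    proof -
      have "g' (y \<times>\<times> y) \<times>\<times> g' (y \<times>\<times> y) = g ((y \<times>\<times> y) \<times>\<times> (y \<times>\<times> y))" for y
        by (simp add: adjoint_identity det_stabiliserD(3)[OF g] det_stabiliser_simps(2)[OF g]
            flip: cross_stabiliser)
      \<comment> \<open>With \<open>y = x \<times>\<times> x\<close> one has
        \<open>y \<times>\<times> y = Dt x *\<^sub>W x\<close>, so both sides acquire the factor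
        \<open>(Dt x)\<^sup>2\<close>.\<close>
      from this[of "x \<times>\<times> x"]
      have "(Dt x)\<^sup>2 *\<^sub>W (g' x \<times>\<times> g' x) = (Dt x)\<^sup>2 *\<^sub>W g (x \<times>\<times> x)"
        by (simp add: adjoint_identity contragredient_simps cross_simps det_stabiliser_simps(2)[OF g]
            power2_eq_square)
      then show ?thesis using that by (simp add: \<delta>_def trace_form_simps)
    qed
  qed
  then show "T (g' x \<times>\<times> g' y) z = T (g (x \<times>\<times> y)) z"
    by (simp add: \<delta>_def trace_form_simps)
qed

text \<open>The determinant is a third of the pairing of \<open>x\<close> with its adjoint, and
  \<open>g'\<close> on \<open>x\<close> is matched by \<open>g\<close> on the adjoint. Membership
  allows conjugation by \<open>g'\<close> on decompositions of the identity.\<close>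

lemma contragredient_in_det_stabiliser: "g' \<in> det_stabiliser \<O>"
  unfolding det_stabiliser_def mem_Collect_eq
proof (intro conjI allI)
  show "Vector_Spaces.linear (hscale \<O>) (hscale \<O>) g'"
    by unfold_locales (simp_all add: contragredient_simps)
  show "bij g'"
  proof (rule bijI)
    show "inj g'"
      by (rule injI, rule trace_form_eqI) (metis trace_contragredient)
    have "g' (\<Sum>k\<in>K. T z (g (e k)) *\<^sub>W f k) = z" for z
    proof (rule eq_by_trace_g)
      fix y
      have "T z (g y) = (\<Sum>k\<in>K. T y (f k) * T z (g (e k)))"
        by (subst expand[of y]) (simp add: det_stabiliser_simps[OF g] trace_form_simps)
      then show "T (g' (\<Sum>k\<in>K. T z (g (e k)) *\<^sub>W f k)) (g y) = T z (g y)"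
        by (simp add: trace_contragredient trace_form_simps trace_form_commute[of "f _" y] mult.commute)
    qed
    then show "surj g'" by (rule surjI)
  qed
  show "Dt (g' x) = Dt x" for x
  proof -
    have "3 * Dt (g' x) = T (g' x) (g' x \<times>\<times> g' x)"
      by (simp add: tri_diag trace_cross_right)
    also have "\<dots> = 3 * Dt x"
      by (simp add: cross_contragredient trace_contragredient tri_diag trace_cross_right)
    finally show ?thesis using three_neq_0 mult_left_cancel by blast
  qed
qed

text \<open>Applying \<open>g\<close> inside a cross product gives \<open>g'\<close> outside, and
  conversely. Hence \<open>a \<times>\<times> b\<close> acquires \<open>g'\<close>, and its cross
  product with an entry of \<open>x m\<close> acquires \<open>g\<close> once that entry is moved by
  \<open>g'\<close>; the other two slots then acquire \<open>g\<close> as well.\<close>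

lemma odot2_stabiliser:
  "conj_act g (odot2 \<O> n x a b)
    = odot2 \<O> n (\<lambda>m i. g' (x m i)) (\<lambda>i. g (a i)) (\<lambda>i. g (b i))"
  unfolding odot2_def
  by (simp add: conj_act_simps[OF g] conj_act_sum[OF det_stabiliserD(1)[OF g]]
      conj_act_triple_op[OF g] cross_stabiliser cross_contragredient f_prime_def tri_stabiliser[OF g])

lemma id_decomposition_contragredient:
  assumes "id_decomposition \<O> n x"
  shows "id_decomposition \<O> n (\<lambda>m i. g' (x m i))"
proof -
  note g' = contragredient_in_det_stabiliser
  have "(\<Sum>m<n. op_of \<O> (\<lambda>i. g' (x m i))) = conj_act g' (\<Sum>m<n. op_of \<O> (x m))"
    by (simp add: conj_act_op_of[OF g'] conj_act_sum[OF det_stabiliserD(1)[OF g']])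
  then show ?thesis
    using assms by (simp add: id_decomposition_def conj_act_simps[OF g'])
qed

text \<open>By bilinearity it is enough to treat generators. There \<open>odot2_stabiliser\<close>
  changes the decomposition \<open>x\<close> into its image under \<open>g'\<close>, and
  \<open>odot2_eq_odot\<close> applies to either decomposition.\<close>

lemma odot_stabiliser:
  assumes x: "id_decomposition \<O> n x" and A: "A \<in> sigma_A \<O>" and C: "C \<in> sigma_A \<O>"
  shows "odot (conj_act g A) (conj_act g C) = conj_act g (odot A C)"
  using A
proof (induct rule: sigma_A_induct)
  case subspace
  show ?case
    using odot_scale_left[of 0]
    by (auto simp: ops.subspace_def conj_act_simps[OF g] odot_add_left odot_scale_left)
next
  case (op_of a)
  show ?case
    using C
  proof (induct rule: sigma_A_induct)
    case subspace
    show ?case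
      using odot_scale_right[of _ 0]
      by (auto simp: ops.subspace_def conj_act_simps[OF g] odot_add_right odot_scale_right)
  next
    case (op_of b)
    show ?case
      using odot2_stabiliser[of n x a b]
      by (simp add: odot2_eq_odot x id_decomposition_contragredient conj_act_op_of[OF g])
  qed
qed

lemma conj_act_sigma_A:
  assumes "A \<in> sigma_A \<O>"
  shows "conj_act g A \<in> sigma_A \<O> \<and> optr (conj_act g A) = optr A"
  using assms
proof (induct rule: sigma_A_induct)
  case subspace
  show ?case
    using ops.subspace_0[OF subspace_sigma_A]
    by (auto simp: ops.subspace_def conj_act_simps[OF g] optr_add optr_scale
        ops.subspace_add[OF subspace_sigma_A] ops.subspace_scale[OF subspace_sigma_A])
next
  case (op_of a)
  show ?case
    unfolding op_of_def conj_act_triple_op[OF g] optr_triple_op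
    by (simp add: triple_op_in_sigma_A tri_stabiliser[OF g])
qed

end

lemma sigma_V_eq: "sigma_V \<O> = {A \<in> sigma_A \<O>. optr A = 0}"
  unfolding sigma_V_def using endo_trace_eq[OF linear_sigma_A] by auto

end

theorem proposition4p17:
  fixes \<O> :: "('k::alg_closed_field, 'o::ab_group_add) octonion_data"
    and n :: nat and x :: "nat \<Rightarrow> nat \<Rightarrow> ('k, 'o) herm3"
  assumes "CHAR('k) = 0 \<or> CHAR('k) \<ge> 14"
    and "split_octonion_algebra \<O>"
    and "id_decomposition \<O> n x"
  shows "\<exists>P.
    bilinear_on (escale \<O>) (sigma_A \<O>) P \<and>
    (\<forall>a b. P (op_of \<O> a) (op_of \<O> b) = odot2 \<O> n x a b) \<and>
    (\<forall>n' x'. id_decomposition \<O> n' x' \<longrightarrow> (\<forall>a b. odot2 \<O> n' x' a b = odot2 \<O> n x a b)) \<and>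
    (\<forall>A\<in>sigma_V \<O>. \<forall>B\<in>sigma_V \<O>. P A B \<in> sigma_V \<O>) \<and>
    (\<forall>A\<in>sigma_V \<O>. \<forall>B\<in>sigma_V \<O>. P A B = P B A) \<and>
    (\<forall>g\<in>det_stabiliser \<O>. \<forall>A\<in>sigma_V \<O>. conj_act g A \<in> sigma_V \<O>) \<and>
    (\<forall>g\<in>det_stabiliser \<O>. \<forall>A\<in>sigma_V \<O>. \<forall>B\<in>sigma_V \<O>.
      P (conj_act g A) (conj_act g B) = conj_act g (P A B))"
proof -
  \<comment> \<open>If the image of \<open>m\<close> were zero, the characteristic would divide
    \<open>m\<close>, hence be positive and at most \<open>m\<close>.\<close>
  have "of_nat m \<noteq> (0::'k)" if "0 < m" "m < 14" for m
    using that assms(1) by (auto simp: of_nat_eq_0_iff_char_dvd dest: dvd_imp_le)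
  from this[of 2] this[of 3] interpret albert_algebra \<O>
    by unfold_locales (simp_all add: assms infinite_alg_closed_field)
  obtain K :: "(nat \<times> 'o option) set" and e f where "albert_dual_bases \<O> K e f"
  proof (rule dual_bases)
    fix K :: "(nat \<times> 'o option) set" and e f
    assume "finite K" "\<And>w. w = (\<Sum>k\<in>K. T w (f k) *\<^sub>W e k)" "(\<Sum>k\<in>K. T (e k) (f k)) = 27"
      "\<And>p q. (\<Sum>k\<in>K. T (p \<times>\<times> e k) (q \<times>\<times> f k)) = 5 / 2 * T p q"
    then show ?thesis by (intro that[of K e f]) unfold_locales
  qed
  then interpret albert_dual_bases \<O> K e f .
  show ?thesis
  proof (intro exI[of _ odot] conjI allI ballI impI)
    show "bilinear_on (escale \<O>) (sigma_A \<O>) odot"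
      by (simp add: bilinear_on_def odot_add_left odot_add_right odot_scale_left odot_scale_right)
    show "odot (op_of \<O> a) (op_of \<O> b) = odot2 \<O> n x a b" for a b
      by (simp add: odot2_eq_odot assms)
    show "odot2 \<O> n' x' a b = odot2 \<O> n x a b" if "id_decomposition \<O> n' x'" for n' x' a b
      by (simp add: odot2_eq_odot assms that)
    show "odot A C \<in> sigma_V \<O>" if "A \<in> sigma_V \<O>" "C \<in> sigma_V \<O>" for A C
      using that odot_in_sigma_A[OF id_in_sigma_A[OF assms(3)]] by (simp add: sigma_V_eq optr_odot)
    show "odot A C = odot C A" for A C
      by (rule odot_commute)
    show "conj_act g A \<in> sigma_V \<O>" if "g \<in> det_stabiliser \<O>" "A \<in> sigma_V \<O>" for g A
      using that conj_act_sigma_A by (simp add: sigma_V_eq)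
    show "odot (conj_act g A) (conj_act g C) = conj_act g (odot A C)"
      if "g \<in> det_stabiliser \<O>" "A \<in> sigma_V \<O>" "C \<in> sigma_V \<O>" for g A C
      using that odot_stabiliser[OF _ assms(3)] by (simp add: sigma_V_eq)
  qed
qed

end
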